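(* Let $\epsilon>0$ be the desired accuracy, $R\ge1$ with $e^R=\mathcal{O}(1)$, and let $L$ be large enough that $$e^{-\pi L+2\lambda_{\max}^+(H_1^A)T+R+1}\le\epsilon,\qquad e^{-\pi L+\lambda_{\max}^-(H_1^A)T+\lambda_{\max}^+(H_1^A)T+R+1}\le\epsilon .$$ Let $\tilde\Omega_p=(p^{\gamma,\Diamond},p^{\gamma,\Diamond}+R)$ and let the approximation $\boldsymbol{u}_h^d$ be $$\boldsymbol{u}_h^d(T,p)=e^p\sum_{l\in[N_p]}(\langle l|\otimes\langle0|\otimes I)\,\tilde{\boldsymbol{w}}_{f,h}^\gamma(T)\,e^{i\mu_l(p+\pi L)},\qquad p\in\tilde\Omega_p .$$ Then there is a constant $C>0$ independent of the numerical mesh size (and time step) such that, at time $T$, $$\|\boldsymbol{u}_h^d-\boldsymbol{u}\|_{L^2(\tilde\Omega_p)}\le C\Big(\triangle p\,e^{p^{\Diamond}}\big(\|\boldsymbol{u}(T)\|+C_T|b|\,\|\boldsymbol{r}_0\|\big)+\epsilon\big(\|\boldsymbol{u}_0\|+C_T|b|\,\|\boldsymbol{r}_0\|\big)\Big).$$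
   Context: Fix $T>0$, $A:[0,T]\to\mathbb{C}^{n\times n}$ and $\boldsymbol{b}=(b_1,\dots,b_n):[0,T]\to\mathbb{C}^n$ continuous, $\boldsymbol{b}\not\equiv\boldsymbol{0}$, $\boldsymbol{u}_0\in\mathbb{C}^n$; $\boldsymbol{u}$ solves $\frac{\mathrm{d}}{\mathrm{d}t}\boldsymbol{u}=A(t)\boldsymbol{u}+\boldsymbol{b}(t)$, $\boldsymbol{u}(0)=\boldsymbol{u}_0$, and $\boldsymbol{u}(T)$ is regarded as a constant function of $p$. Set $B=\mathrm{diag}\{b_1,\dots,b_n\}$, $|b|=\max_t\|\boldsymbol{b}(t)\|_{l^\infty}$, $\boldsymbol{r}_0=(1,\dots,1)^\top\in\mathbb{R}^n$, $\gamma=1/(C_T|b|)$ where $C_T=\mathcal{O}(1)$, $C_T\ge T$. Put $H_1^A=(A+A^\dagger)/2$, $H_2^A=(A-A^\dagger)/(2i)$, $$H_1^\gamma=\begin{bmatrix}H_1^A&\frac{\gamma B}{2}\\\frac{\gamma B^\dagger}{2}&O\end{bmatrix},\qquad H_2^\gamma=\begin{bmatrix}H_2^A&\frac{\gamma B}{2i}\\-\frac{\gamma B^\dagger}{2i}&O\end{bmatrix}.$$ With $\sigma(\cdot)$ the set of eigenvalues, $\lambda_{\max}^{\pm}(H_1^A)=\max\{\sup_{0<t<T}\{|\lambda|:\lambda\in\sigma(H_1^A(t)),\pm\lambda>0\},0\}$. Let $p^{\Diamond}=\lambda_{\max}^+(H_1^A)T$ and let $p^{\gamma,\Diamond}=p^{\Diamond}+\mathcal{O}(\gamma|b|T)=\lambda_{\max}^+(H_1^A)T+\mathcal{O}(1)$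 be a recovery threshold, i.e. chosen with $p^{\gamma,\Diamond}\ge\lambda_{\max}^+(H_1^\gamma)T$ (same definition of $\lambda_{\max}^+$). $\|\cdot\|$ is the Euclidean norm. Discretization. For even $N_p$, $\triangle p=2\pi L/N_p$, $p_k=-\pi L+k\triangle p$, $[N_p]=\{0,\dots,N_p-1\}$, $\mu_l=(l-N_p/2)/L$, $\Phi=(e^{i\mu_l(p_j+\pi L)})_{j,l\in[N_p]}$, $D_p=\mathrm{diag}\{\mu_0,\dots,\mu_{N_p-1}\}$, $\psi_h=\sum_{k\in[N_p]}e^{-|p_k|}|k\rangle$. Then $\tilde{\boldsymbol{w}}_{f,h}^\gamma(t)\in\mathbb{C}^{N_p}\otimes\mathbb{C}^2\otimes\mathbb{C}^n$ solves (exactly in time) $$\frac{\mathrm{d}}{\mathrm{d}t}\tilde{\boldsymbol{w}}_{f,h}^\gamma=-i(D_p\otimes H_1^\gamma-I\otimes H_2^\gamma)\tilde{\boldsymbol{w}}_{f,h}^\gamma,\qquad \tilde{\boldsymbol{w}}_{f,h}^\gamma(0)=(\Phi^{-1}\otimes I)\Big(\psi_h\otimes\begin{bmatrix}\boldsymbol{u}_0\\C_T|b|\boldsymbol{r}_0\end{bmatrix}\Big).$$ $\langle0|\otimes I:\mathbb{C}^2\otimes\mathbb{C}^n\to\mathbb{C}^n$ selects the first $n$ components. *)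

theory Defs
  imports "HOL-Analysis.Analysis"
begin

section \<open>Matrices\<close>

definition adj :: "complex^'n^'m \<Rightarrow> complex^'m^'n" where
  "adj M = map_matrix cnj (transpose M)"

definition herm1 :: "complex^'n^'n \<Rightarrow> complex^'n^'n" where
  "herm1 A = (1/2) *\<^sub>R (A + adj A)"

definition herm2 :: "complex^'n^'n \<Rightarrow> complex^'n^'n" where
  "herm2 A = map_matrix (\<lambda>z. z / (2 * \<i>)) (A - adj A)"

definition diag_mat :: "complex^'n \<Rightarrow> complex^'n^'n" where
  "diag_mat v = (\<chi> i j. if i = j then v $ i else 0)"

definition eigvals :: "complex^'n^'n \<Rightarrow> complex set" where
  "eigvals M = {x. \<exists>v. v \<noteq> 0 \<and> M *v v = x *s v}"

text \<open>\<open>\<complex>\<^sup>2 \<otimes> \<complex>\<^sup>n\<close> is indexed by the sum type \<open>'n + 'n\<close>: \<open>Inl\<close> for the block selected by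
  \<open>\<langle>0|\<close> and \<open>Inr\<close> for the block selected by \<open>\<langle>1|\<close>.\<close>

definition block_vec :: "'a^'n \<Rightarrow> 'a^'n \<Rightarrow> 'a^('n + 'n)" where
  "block_vec x y = (\<chi> r. case r of Inl i \<Rightarrow> x $ i | Inr i \<Rightarrow> y $ i)"

definition block_fst :: "'a^('n + 'n) \<Rightarrow> 'a^'n" where
  "block_fst w = (\<chi> i. w $ Inl i)"

definition block_mat ::
  "'a^'n^'n \<Rightarrow> 'a^'n^'n \<Rightarrow> 'a^'n^'n \<Rightarrow> 'a^'n^'n \<Rightarrow> 'a^('n + 'n)^('n + 'n)" where
  "block_mat P Q R S = (\<chi> r c. case r of
      Inl i \<Rightarrow> (case c of Inl j \<Rightarrow> P $ i $ j | Inr j \<Rightarrow> Q $ i $ j)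
    | Inr i \<Rightarrow> (case c of Inl j \<Rightarrow> R $ i $ j | Inr j \<Rightarrow> S $ i $ j))"

definition H1g :: "real \<Rightarrow> complex^'n^'n \<Rightarrow> complex^'n \<Rightarrow> complex^('n + 'n)^('n + 'n)" where
  "H1g \<gamma> A b = block_mat
     (herm1 A) (map_matrix (\<lambda>z. of_real \<gamma> * z / 2) (diag_mat b))
     (map_matrix (\<lambda>z. of_real \<gamma> * z / 2) (adj (diag_mat b))) 0"

definition H2g :: "real \<Rightarrow> complex^'n^'n \<Rightarrow> complex^'n \<Rightarrow> complex^('n + 'n)^('n + 'n)" where
  "H2g \<gamma> A b = block_mat
     (herm2 A) (map_matrix (\<lambda>z. of_real \<gamma> * z / (2 * \<i>)) (diag_mat b))
     (map_matrix (\<lambda>z. - (of_real \<gamma> * z / (2 * \<i>))) (adj (diag_mat b))) 0"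

section \<open>Quantities attached to the data\<close>

text \<open>The value 0 is inserted before taking the supremum, rather than taking the maximum with 0
  afterwards, because the set of eigenvalues of the given sign may be empty and the supremum of
  the empty set of reals is unspecified.\<close>

definition lam_max_pos :: "real \<Rightarrow> (real \<Rightarrow> complex^'n^'n) \<Rightarrow> real" where
  "lam_max_pos T H =
     Sup (insert 0 {\<bar>x\<bar> | x t. 0 < t \<and> t < T \<and> complex_of_real x \<in> eigvals (H t) \<and> x > 0})"

definition lam_max_neg :: "real \<Rightarrow> (real \<Rightarrow> complex^'n^'n) \<Rightarrow> real" where
  "lam_max_neg T H =
     Sup (insert 0 {\<bar>x\<bar> | x t. 0 < t \<and> t < T \<and> complex_of_real x \<in> eigvals (H t) \<and> x < 0})"

text \<open>The library's \<open>infnorm\<close> is not the maximum of the moduli of the components on complex vectors: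
  it treats real and imaginary parts as separate coordinates.\<close>

definition linf_norm :: "complex^'n \<Rightarrow> real" where
  "linf_norm v = Max (range (\<lambda>i. cmod (v $ i)))"

text \<open>For continuous \<open>b\<close> the supremum is a maximum.\<close>

definition b_max :: "real \<Rightarrow> (real \<Rightarrow> complex^'n) \<Rightarrow> real" where
  "b_max T b = (SUP t\<in>{0..T}. linf_norm (b t))"

definition r0 :: "complex^'n" where
  "r0 = (\<chi> i. 1)"

section \<open>Discretization in the auxiliary variable\<close>

text \<open>Since the number \<open>N\<close> of grid points varies within the statement, \<open>N\<close> by \<open>N\<close> matrices and
  vectors with \<open>N\<close> blocks are functions on \<open>nat\<close>, of which only the values at arguments below \<open>N\<close>
  are relevant.\<close>

definition dp :: "real \<Rightarrow> nat \<Rightarrow> real" where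
  "dp L N = 2 * pi * L / real N"

definition grid :: "real \<Rightarrow> nat \<Rightarrow> nat \<Rightarrow> real" where
  "grid L N k = - pi * L + real k * dp L N"

definition mu :: "real \<Rightarrow> nat \<Rightarrow> nat \<Rightarrow> real" where
  "mu L N l = (real l - real N / 2) / L"

definition Phi :: "real \<Rightarrow> nat \<Rightarrow> nat \<Rightarrow> nat \<Rightarrow> complex" where
  "Phi L N j l = exp (\<i> * of_real (mu L N l * (grid L N j + pi * L)))"

definition Dp :: "real \<Rightarrow> nat \<Rightarrow> nat \<Rightarrow> nat \<Rightarrow> complex" where
  "Dp L N j l = (if j = l then of_real (mu L N l) else 0)"

definition id_N :: "nat \<Rightarrow> nat \<Rightarrow> complex" where
  "id_N j l = (if j = l then 1 else 0)"

text \<open>The analogue of \<open>matrix_inv\<close> for this representation.\<close>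

definition inv_N :: "nat \<Rightarrow> (nat \<Rightarrow> nat \<Rightarrow> complex) \<Rightarrow> nat \<Rightarrow> nat \<Rightarrow> complex" where
  "inv_N N M = (SOME M'. \<forall>i<N. \<forall>j<N.
      (\<Sum>k<N. M i k * M' k j) = id_N i j \<and> (\<Sum>k<N. M' i k * M k j) = id_N i j)"

definition psi_h :: "real \<Rightarrow> nat \<Rightarrow> nat \<Rightarrow> complex" where
  "psi_h L N k = of_real (exp (- \<bar>grid L N k\<bar>))"

definition tensor_vec :: "(nat \<Rightarrow> complex) \<Rightarrow> complex^'m \<Rightarrow> nat \<Rightarrow> complex^'m" where
  "tensor_vec x v = (\<lambda>k. x k *s v)"

text \<open>The Kronecker product of \<open>M\<close> and \<open>H\<close> applied to a block vector.\<close>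

definition tensor_mv ::
  "nat \<Rightarrow> (nat \<Rightarrow> nat \<Rightarrow> complex) \<Rightarrow> complex^'m^'m \<Rightarrow> (nat \<Rightarrow> complex^'m) \<Rightarrow> nat \<Rightarrow> complex^'m" where
  "tensor_mv N M H w = (\<lambda>j. \<Sum>l<N. M j l *s (H *v w l))"

text \<open>\<open>c\<close> is the constant \<open>C\<^sub>T\<close>, and the coupling parameter is \<open>\<gamma> = 1 / (C\<^sub>T |b|)\<close>.\<close>

definition gam :: "real \<Rightarrow> real \<Rightarrow> (real \<Rightarrow> complex^'n) \<Rightarrow> real" where
  "gam T c b = 1 / (c * b_max T b)"

definition semidiscrete_sol ::
  "real \<Rightarrow> (real \<Rightarrow> complex^'n^'n) \<Rightarrow> (real \<Rightarrow> complex^'n) \<Rightarrow> complex^'n \<Rightarrow> real \<Rightarrow> real \<Rightarrow> nat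
    \<Rightarrow> (real \<Rightarrow> nat \<Rightarrow> complex^('n + 'n)) \<Rightarrow> bool" where
  "semidiscrete_sol T A b u0 c L N w \<longleftrightarrow>
     (\<forall>j<N. w 0 j =
        tensor_mv N (inv_N N (Phi L N)) (mat 1)
          (tensor_vec (psi_h L N) (block_vec u0 (complex_of_real (c * b_max T b) *s r0))) j) \<and>
     (\<forall>t\<in>{0..T}. \<forall>j<N.
        ((\<lambda>s. w s j) has_vector_derivative
          (- \<i>) *s (tensor_mv N (Dp L N) (H1g (gam T c b) (A t) (b t)) (w t) j
                    - tensor_mv N id_N (H2g (gam T c b) (A t) (b t)) (w t) j))
        (at t within {0..T}))"

definition u_approx ::
  "real \<Rightarrow> nat \<Rightarrow> (nat \<Rightarrow> complex^('n + 'n)) \<Rightarrow> real \<Rightarrow> complex^'n" where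
  "u_approx L N w p = exp p *\<^sub>R
     (\<Sum>l<N. exp (\<i> * of_real (mu L N l * (p + pi * L))) *s block_fst (w l))"

definition L2_norm_on :: "real set \<Rightarrow> (real \<Rightarrow> complex^'n) \<Rightarrow> real" where
  "L2_norm_on S f = sqrt (set_lebesgue_integral lborel S (\<lambda>p. (norm (f p))\<^sup>2))"

end

theory Submission
  imports Defs
begin

text \<open>
  Let \<open>W\<^sub>h\<close> be the trigonometric polynomial in \<open>p\<close> with coefficients \<open>w t l\<close>. Both \<open>W\<^sub>h\<close> and
  \<open>e\<^sup>-\<^sup>p (u, r)\<close>, where \<open>r\<close> is the constant that turns the inhomogeneous equation for \<open>u\<close> into a
  homogeneous one, are smooth and solve the symmetric hyperbolic system
  \<open>\<partial>\<^sub>t E = - H\<^sub>1 \<partial>\<^sub>p E + \<i> H\<^sub>2 E\<close> exactly, so their difference \<open>E\<close> does too. The energy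
  of \<open>E\<close> over an interval whose left end moves with speed \<open>\<lambda>\<^sub>m\<^sub>a\<^sub>x\<^sup>+(H\<^sub>1)\<close> and whose right end
  moves inwards with a large speed \<open>\<Lambda>\<close> cannot grow. Hence the error on \<open>(p\<^sup>\<gamma>, p\<^sup>\<gamma> + R)\<close> at time \<open>T\<close> is
  controlled by the initial error on \<open>(0, M)\<close> with \<open>M\<close> bounded in terms of \<open>T\<close>, \<open>A\<close> and \<open>K\<close>, which is
  an error of trigonometric interpolation of \<open>e\<^sup>-\<^sup>p\<close>.

  If \<open>M \<le> \<pi> L\<close>, this interpolation error is \<open>O(\<triangle>p)\<close>: it vanishes at the grid points, so it is at most
  \<open>\<triangle>p\<close> times its derivative on each cell, and the derivative of the interpolant is
  controlled by the finite differences of the data. If \<open>\<pi> L < M\<close>, then \<open>\<epsilon>\<close> is bounded below by \<open>e\<^sup>-\<^sup>M\<close> and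
  a crude bound suffices. The norm of the initial value is traded for that of \<open>u T\<close> by integrating
  the equation backwards.
\<close>

section \<open>Energy estimates\<close>

text \<open>The energy changes only through the two ends of the interval. The left end moves right
  at speed \<open>lam\<close>, at least as fast as anything transported by \<open>H\<close>. The
  right end moves left at speed \<open>Lam\<close>, at least as fast as anything coming in. Hence
  both boundary terms are nonpositive. The bounds on \<open>H\<close> are asked for on the open time
  interval only, which is where \<open>lam_max_pos\<close> looks.\<close>

lemma energy_trapezoid:
  fixes E Et Ep :: "real \<Rightarrow> real \<Rightarrow> 'v::euclidean_space" and H S :: "real \<Rightarrow> 'v \<Rightarrow> 'v"
  assumes T: "0 < T"
    and deriv: "\<And>t p. t \<in> {0..T} \<Longrightarrow> ((\<lambda>z. E (fst z) (snd z)) has_derivative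
        (\<lambda>h. fst h *\<^sub>R Et t p + snd h *\<^sub>R Ep t p)) (at (t, p) within {0..T} \<times> UNIV)"
    and cont_Et: "continuous_on ({0..T} \<times> UNIV) (\<lambda>z. Et (fst z) (snd z))"
    and cont_Ep: "continuous_on ({0..T} \<times> UNIV) (\<lambda>z. Ep (fst z) (snd z))"
    and pde: "\<And>t p. t \<in> {0..T} \<Longrightarrow> Et t p = S t (E t p) - H t (Ep t p)"
    and lin: "\<And>t. bounded_linear (H t)"
    and sym: "\<And>t x y. inner (H t x) y = inner x (H t y)"
    and skew: "\<And>t x. inner x (S t x) = 0"
    and upper: "\<And>t x. 0 < t \<Longrightarrow> t < T \<Longrightarrow> inner x (H t x) \<le> lam * (norm x)\<^sup>2"
    and lower: "\<And>t x. 0 < t \<Longrightarrow> t < T \<Longrightarrow> - (Lam * (norm x)\<^sup>2) \<le> inner x (H t x)"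
    and ab: "a + lam * T \<le> b - Lam * T" "a \<le> b"
  shows "integral {a + lam * T..b - Lam * T} (\<lambda>p. (norm (E T p))\<^sup>2) \<le> integral {a..b} (\<lambda>p. (norm (E 0 p))\<^sup>2)"
proof -
  define len where "len t = (b - Lam * t) - (a + lam * t)" for t
  \<comment> \<open>The moving interval is pulled back to \<open>{0..1}\<close>, so that the energy
    is differentiated under an integral with fixed limits; \<open>v s\<close> is the velocity of the
    point \<open>pos t s\<close>.\<close>
  define pos where "pos t s = a + lam * t + s * len t" for t s
  define v where "v s = lam - s * (lam + Lam)" for s
  define g where "g t s = len t * (norm (E t (pos t s)))\<^sup>2" for t s
  define gt where "gt t s = - (lam + Lam) * (norm (E t (pos t s)))\<^sup>2
      + len t * (2 * inner (E t (pos t s)) (Et t (pos t s) + v s *\<^sub>R Ep t (pos t s)))" for t s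
  \<comment> \<open>An antiderivative of \<open>gt t\<close> in \<open>s\<close>: the energy flux
    relative to the moving point. Since \<open>v 0 = lam\<close> and \<open>v 1 = - Lam\<close>, its
    sign is known at both ends.\<close>
  define q where "q t s = v s * (norm (E t (pos t s)))\<^sup>2 - inner (E t (pos t s)) (H t (E t (pos t s)))" for t s
  have len_nonneg: "len t \<ge> 0" if "t \<in> {0..T}" for t
  proof -
    \<comment> \<open>The length is affine in \<open>t\<close>, hence a convex combination of its
      values at 0 and \<open>T\<close>.\<close>
    have "len t = (1 - t/T) * (b - a) + (t/T) * ((b - Lam * T) - (a + lam * T))"
      using T by (simp add: len_def field_simps)
    also have "\<dots> \<ge> 0"
      using that T ab by (intro add_nonneg_nonneg mult_nonneg_nonneg) auto
    finally show ?thesis .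
  qed
  have cont_E: "continuous_on ({0..T} \<times> UNIV) (\<lambda>z. E (fst z) (snd z))"
    by (rule has_derivative_continuous_on[where f' = "\<lambda>w h. fst h *\<^sub>R Et (fst w) (snd w) + snd h *\<^sub>R Ep (fst w) (snd w)"])
      (use deriv in auto)
  have cpos: "continuous_on A (\<lambda>z. pos (fst z) (snd z))" for A
    unfolding pos_def len_def by (intro continuous_intros)
  have comp: "continuous_on ({0..T} \<times> {0..1}) (\<lambda>z. F (fst z) (pos (fst z) (snd z)))"
    if "continuous_on ({0..T} \<times> UNIV) (\<lambda>z. F (fst z) (snd z))" for F :: "real \<Rightarrow> real \<Rightarrow> 'v"
    by (rule continuous_on_compose2[OF that, where f = "\<lambda>z. (fst z, pos (fst z) (snd z))", simplified])
      (auto intro!: continuous_intros cpos)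
  note cE = comp[OF cont_E] and cEt = comp[OF cont_Et] and cEp = comp[OF cont_Ep]
  have cont_gt: "continuous_on ({0..T} \<times> {0..1}) (\<lambda>z. gt (fst z) (snd z))"
    unfolding gt_def v_def len_def by (intro continuous_intros cE cEt cEp)
  have cE1: "continuous_on {0..1} (\<lambda>s. F t (pos t s))"
    if "continuous_on ({0..T} \<times> {0..1}) (\<lambda>z. F (fst z) (pos (fst z) (snd z)))" "t \<in> {0..T}"
    for F :: "real \<Rightarrow> real \<Rightarrow> 'v" and t
    by (rule continuous_on_compose2[OF that(1), where f = "\<lambda>s. (t, s)", simplified])
      (use that in \<open>auto intro!: continuous_intros\<close>)
  have chain_t: "((\<lambda>t. E t (pos t s)) has_vector_derivative (Et t (pos t s) + v s *\<^sub>R Ep t (pos t s)))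
      (at t within {0..T})" if t: "t \<in> {0..T}" for t s
  proof -
    have f: "((\<lambda>t. (t, pos t s)) has_derivative (\<lambda>h. (h, v s * h))) (at t within {0..T})"
      unfolding pos_def len_def v_def
      by (auto intro!: derivative_eq_intros simp: algebra_simps)
    have "((\<lambda>z. E (fst z) (snd z)) \<circ> (\<lambda>t. (t, pos t s)) has_derivative
        (\<lambda>h. fst h *\<^sub>R Et t (pos t s) + snd h *\<^sub>R Ep t (pos t s)) \<circ> (\<lambda>h. (h, v s * h))) (at t within {0..T})"
      by (rule diff_chain_within[OF f]) (rule has_derivative_subset[OF deriv[OF t]], auto)
    then show ?thesis
      by (simp add: has_vector_derivative_def o_def algebra_simps)
  qed
  have chain_s: "((\<lambda>s. E t (pos t s)) has_vector_derivative (len t *\<^sub>R Ep t (pos t s)))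
      (at s within {0..1})" if t: "t \<in> {0..T}" for t s
  proof -
    have f: "((\<lambda>s. (t, pos t s)) has_derivative (\<lambda>h. (0, len t * h))) (at s within {0..1})"
      unfolding pos_def by (auto intro!: derivative_eq_intros simp: algebra_simps)
    have "((\<lambda>z. E (fst z) (snd z)) \<circ> (\<lambda>s. (t, pos t s)) has_derivative
        (\<lambda>h. fst h *\<^sub>R Et t (pos t s) + snd h *\<^sub>R Ep t (pos t s)) \<circ> (\<lambda>h. (0, len t * h))) (at s within {0..1})"
      by (rule diff_chain_within[OF f]) (rule has_derivative_subset[OF deriv[OF t]], use t in auto)
    then show ?thesis
      by (simp add: has_vector_derivative_def o_def algebra_simps)
  qed
  have Fderiv: "((\<lambda>t. integral {0..1} (g t)) has_vector_derivative integral {0..1} (gt t)) (at t within {0..T})"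
    if t: "t \<in> {0..T}" for t
  proof -
    have "((\<lambda>t. integral (cbox 0 1) (g t)) has_vector_derivative integral (cbox 0 1) (gt t)) (at t within {0..T})"
    proof (rule leibniz_rule_vector_derivative)
      fix t s :: real assume "t \<in> {0..T}" "s \<in> cbox 0 1"
      note ch = chain_t[OF this(1), unfolded has_vector_derivative_def]
      have "((\<lambda>t. len t * (inner (E t (pos t s)) (E t (pos t s)))) has_derivative (\<lambda>h. h *\<^sub>R gt t s)) (at t within {0..T})"
        unfolding len_def
        by (rule derivative_eq_intros ch refl)+
          (auto simp: gt_def len_def power2_norm_eq_inner inner_commute algebra_simps fun_eq_iff)
      then show "((\<lambda>t. g t s) has_vector_derivative gt t s) (at t within {0..T})"
        by (simp add: has_vector_derivative_def g_def power2_norm_eq_inner)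
    next
      fix t assume "t \<in> {0..T}"
      then show "g t integrable_on cbox 0 1"
        unfolding g_def
        by (intro integrable_continuous) (auto intro!: continuous_intros cE1[OF cE])
    qed (use t cont_gt in \<open>auto simp: split_beta\<close>)
    then show ?thesis by simp
  qed
  \<comment> \<open>Skewness removes the term with \<open>S\<close>, and symmetry of
    \<open>H\<close> makes \<open>2 * inner E (H Ep)\<close> an exact derivative in
    \<open>p\<close>.\<close>
  have flux: "integral {0..1} (gt t) = q t 1 - q t 0" if t: "t \<in> {0..T}" for t
  proof -
    have "(gt t has_integral (q t 1 - q t 0)) {0..1}"
    proof (rule fundamental_theorem_of_calculus)
      fix s :: real assume "s \<in> {0..1}"
      note ch = chain_s[OF t, unfolded has_vector_derivative_def]
      let ?x = "E t (pos t s)" and ?d = "Ep t (pos t s)"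
      have key: "inner ?x (Et t (pos t s)) = - inner ?x (H t ?d)"
        by (simp add: pde[OF t] inner_diff_right skew)
      have sy: "inner ?d (H t ?x) = inner ?x (H t ?d)"
        using sym[of t ?d ?x] by (simp add: inner_commute)
      have Hl: "H t (c *\<^sub>R x) = c *\<^sub>R H t x" for c x
        using lin[of t] by (simp add: linear_simps)
      have "((\<lambda>s. v s * inner (E t (pos t s)) (E t (pos t s)) - inner (E t (pos t s)) (H t (E t (pos t s))))
         has_derivative (\<lambda>h. h *\<^sub>R gt t s)) (at s within {0..1})"
        unfolding v_def
        by (rule derivative_eq_intros ch refl bounded_linear.has_derivative[OF lin])+
          (auto simp: gt_def v_def power2_norm_eq_inner inner_commute algebra_simps fun_eq_iff key sy Hl
            inner_add_right)
      then show "(q t has_vector_derivative gt t s) (at s within {0..1})"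
        by (simp add: has_vector_derivative_def q_def[abs_def] power2_norm_eq_inner)
    qed simp
    then show ?thesis by (rule integral_unique)
  qed
  have le: "integral {0..1} (g T) \<le> integral {0..1} (g 0)"
  \<comment> \<open>Continuity up to the end points is enough there, since a sign of the derivative
    is available only for \<open>0 < t < T\<close>.\<close>
  proof (rule DERIV_nonpos_imp_decreasing_open[of 0 T "\<lambda>t. integral {0..1} (g t)"])
    fix t assume t: "0 < t" "t < T"
    have "((\<lambda>t. integral {0..1} (g t)) has_real_derivative integral {0..1} (gt t)) (at t)"
      using Fderiv[of t] t
      by (simp add: has_real_derivative_iff_has_vector_derivative at_within_Icc_at)
    moreover have "integral {0..1} (gt t) \<le> 0"
      using flux[of t] t upper[OF t, of "E t (pos t 0)"] lower[OF t, of "E t (pos t 1)"]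
      by (simp add: q_def v_def)
    ultimately show "\<exists>y. ((\<lambda>t. integral {0..1} (g t)) has_real_derivative y) (at t) \<and> y \<le> 0" by blast
  next
    show "continuous_on {0..T} (\<lambda>t. integral {0..1} (g t))"
      unfolding continuous_on_eq_continuous_within using has_vector_derivative_continuous[OF Fderiv] by blast
  qed (use T in auto)
  have subst: "integral {0..1} (g t) = integral {a + lam * t..b - Lam * t} (\<lambda>p. (norm (E t p))\<^sup>2)"
    if t: "t \<in> {0..T}" for t
  proof -
    have "((\<lambda>s. len t *\<^sub>R (norm (E t (pos t s)))\<^sup>2) has_integral
        integral {pos t 0..pos t 1} (\<lambda>p. (norm (E t p))\<^sup>2)) {0..1}"
    proof (rule has_integral_substitution[where c = "pos t 0" and d = "pos t 1"])
      show "(pos t has_field_derivative len t) (at s within {0..1})" for s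
        unfolding pos_def by (auto intro!: derivative_eq_intros)
      show "pos t ` {0..1} \<subseteq> {pos t 0..pos t 1}"
        using len_nonneg[OF t] by (auto simp: pos_def mult_left_le_one_le)
      have "continuous_on {pos t 0..pos t 1} (\<lambda>p. E t p)"
        by (rule continuous_on_compose2[OF cont_E, where f = "\<lambda>s. (t, s)", simplified])
          (use t in \<open>auto intro!: continuous_intros\<close>)
      then show "continuous_on {pos t 0..pos t 1} (\<lambda>p. (norm (E t p))\<^sup>2)"
        by (intro continuous_intros)
    qed (use len_nonneg[OF t] in \<open>auto simp: pos_def\<close>)
    then have "integral {0..1} (g t) = integral {pos t 0..pos t 1} (\<lambda>p. (norm (E t p))\<^sup>2)"
      unfolding g_def[abs_def] by (simp only: real_scaleR_def integral_unique)
    then show ?thesis by (simp add: pos_def len_def)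
  qed
  show ?thesis using le subst[of 0] subst[of T] T by simp
qed

text \<open>Cauchy-Schwarz for the integral of \<open>f'\<close>, obtained by integrating the
  nonnegative function |f' - c|^2, where \<open>c\<close> is the mean value of
  \<open>f'\<close>.\<close>

lemma norm_sq_le_integral_deriv:
  fixes f f' :: "real \<Rightarrow> 'v::euclidean_space"
  assumes ab: "a \<le> b" and f: "\<And>x. x \<in> {a..b} \<Longrightarrow> (f has_vector_derivative f' x) (at x within {a..b})"
    and f0: "f a = 0" and cont: "continuous_on {a..b} f'"
  shows "(norm (f b))\<^sup>2 \<le> (b - a) * integral {a..b} (\<lambda>x. (norm (f' x))\<^sup>2)"
proof (cases "a = b")
  case True
  then show ?thesis using f0 by simp
next
  case False
  define c where "c = f b /\<^sub>R (b - a)"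
  have i1: "(f' has_integral f b) {a..b}"
    using fundamental_theorem_of_calculus[OF ab, of f f'] f f0 by simp
  have i2: "((\<lambda>x. (norm (f' x))\<^sup>2) has_integral integral {a..b} (\<lambda>x. (norm (f' x))\<^sup>2)) {a..b}"
    by (intro integrable_integral integrable_continuous_real continuous_intros cont)
  have i3: "((\<lambda>x. inner (f' x) c) has_integral inner (f b) c) {a..b}"
    using has_integral_linear[OF i1 bounded_linear_inner_left[of c]] by (simp add: o_def)
  have i4: "((\<lambda>x. (norm c)\<^sup>2) has_integral (b - a) * (norm c)\<^sup>2) {a..b}"
    using has_integral_const_real[of "(norm c)\<^sup>2" a b] ab by simp
  have "((\<lambda>x. (norm (f' x))\<^sup>2 - 2 * inner (f' x) c + (norm c)\<^sup>2) has_integral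
      integral {a..b} (\<lambda>x. (norm (f' x))\<^sup>2) - 2 * inner (f b) c + (b - a) * (norm c)\<^sup>2) {a..b}"
    by (intro has_integral_add has_integral_diff has_integral_mult_right i2 i3 i4)
  moreover have "(norm (f' x))\<^sup>2 - 2 * inner (f' x) c + (norm c)\<^sup>2 = (norm (f' x - c))\<^sup>2" for x
    by (simp add: power2_norm_eq_inner inner_diff_left inner_diff_right inner_commute)
  ultimately have "0 \<le> integral {a..b} (\<lambda>x. (norm (f' x))\<^sup>2) - 2 * inner (f b) c + (b - a) * (norm c)\<^sup>2"
    by (auto intro: has_integral_nonneg)
  also have "inner (f b) c = (norm (f b))\<^sup>2 / (b - a)"
    by (simp add: c_def power2_norm_eq_inner field_simps)
  also have "(norm c)\<^sup>2 = (norm (f b))\<^sup>2 / (b - a)\<^sup>2"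
    by (simp add: c_def power_mult_distrib power_inverse divide_inverse mult.commute)
  also have "(b - a) * \<dots> = (norm (f b))\<^sup>2 / (b - a)"
    using False by (simp add: power2_eq_square)
  finally have "(norm (f b))\<^sup>2 / (b - a) \<le> integral {a..b} (\<lambda>x. (norm (f' x))\<^sup>2)"
    by simp
  then show ?thesis using False ab by (simp add: pos_divide_le_eq mult.commute)
qed

text \<open>The pointwise bound on each \<open>{a..x}\<close> is integrated once more over
  \<open>{a..b}\<close>. The constant is not sharp; only its quadratic dependence on the length
  matters.\<close>

lemma poincare_zero_left:
  fixes f f' :: "real \<Rightarrow> 'v::euclidean_space"
  assumes ab: "a \<le> b" and f: "\<And>x. x \<in> {a..b} \<Longrightarrow> (f has_vector_derivative f' x) (at x within {a..b})"
    and f0: "f a = 0" and cont: "continuous_on {a..b} f'"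
  shows "integral {a..b} (\<lambda>x. (norm (f x))\<^sup>2) \<le> (b - a)\<^sup>2 * integral {a..b} (\<lambda>x. (norm (f' x))\<^sup>2)"
proof -
  let ?I = "integral {a..b} (\<lambda>x. (norm (f' x))\<^sup>2)"
  have int': "(\<lambda>x. (norm (f' x))\<^sup>2) integrable_on {a..b}"
    by (intro integrable_continuous_real continuous_intros cont)
  have I0: "?I \<ge> 0" by (rule integral_nonneg[OF int']) auto
  have bound: "(norm (f x))\<^sup>2 \<le> (b - a) * ?I" if x: "x \<in> {a..b}" for x
  proof -
    have "(norm (f x))\<^sup>2 \<le> (x - a) * integral {a..x} (\<lambda>x. (norm (f' x))\<^sup>2)"
    proof (rule norm_sq_le_integral_deriv)
      show "(f has_vector_derivative f' y) (at y within {a..x})" if "y \<in> {a..x}" for y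
        by (rule has_vector_derivative_within_subset[OF f]) (use that x in auto)
      show "continuous_on {a..x} f'" by (rule continuous_on_subset[OF cont]) (use x in auto)
    qed (use x f0 in auto)
    also have "\<dots> \<le> (b - a) * ?I"
    proof (intro mult_mono)
      show "integral {a..x} (\<lambda>x. (norm (f' x))\<^sup>2) \<le> ?I"
        by (rule integral_subset_le) (use x int' in \<open>auto intro: integrable_subinterval_real\<close>)
      show "0 \<le> integral {a..x} (\<lambda>x. (norm (f' x))\<^sup>2)"
        by (rule integral_nonneg) (use x int' in \<open>auto intro: integrable_subinterval_real\<close>)
    qed (use x in auto)
    finally show ?thesis .
  qed
  have cf: "continuous_on {a..b} f"
    unfolding continuous_on_eq_continuous_within using has_vector_derivative_continuous[OF f] by blast
  have "integral {a..b} (\<lambda>x. (norm (f x))\<^sup>2) \<le> integral {a..b} (\<lambda>x. (b - a) * ?I)"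
    by (rule integral_le) (auto intro!: integrable_continuous_real continuous_intros cf bound)
  also have "\<dots> = (b - a)\<^sup>2 * ?I" using ab by (simp add: power2_eq_square)
  finally show ?thesis .
qed

text \<open>A maximizer of the quadratic form on the compact unit sphere is an eigenvector. This
  links quadratic form bounds to the eigenvalues over which \<open>lam_max_pos\<close> is
  taken.\<close>

lemma symmetric_form_max_eigenvector:
  fixes H :: "'v::euclidean_space \<Rightarrow> 'v"
  assumes lin: "bounded_linear H" and sym: "\<And>x y. inner (H x) y = inner x (H y)"
  obtains v m where "v \<noteq> 0" "H v = m *\<^sub>R v" "\<And>x. inner x (H x) \<le> m * (norm x)\<^sup>2"
proof -
  interpret bounded_linear H by fact
  have "continuous_on (sphere 0 1) (\<lambda>x. inner x (H x))"
    by (intro continuous_intros linear_continuous_on lin)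
  moreover have "sphere (0::'v) 1 \<noteq> {}" by simp
  ultimately obtain v where v: "norm v = 1" and max: "\<And>x. norm x = 1 \<Longrightarrow> inner x (H x) \<le> inner v (H v)"
    using continuous_attains_sup[OF compact_sphere, of 0 1 "\<lambda>x. inner x (H x)"] by auto
  define m where "m = inner v (H v)"
  have bound: "inner x (H x) \<le> m * (norm x)\<^sup>2" for x
  proof (cases "x = 0")
    case False
    have "inner (x /\<^sub>R norm x) (H (x /\<^sub>R norm x)) \<le> m"
      unfolding m_def by (rule max) (use False in simp)
    then show ?thesis using False by (simp add: scaleR power2_eq_square field_simps)
  qed (simp add: zero)
  \<comment> \<open>The residual of the eigenvalue equation. Perturbing the maximizer in this
    direction changes the gap in the bound to first order by 2 s |y|^2, which is impossible for
    small negative \<open>s\<close> unless \<open>y = 0\<close>.\<close>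
  define y where "y = m *\<^sub>R v - H v"
  have vy: "inner v (H y) = inner (H v) y" using sym by simp
  have quad: "0 \<le> 2 * s * (norm y)\<^sup>2 + s\<^sup>2 * (m * (norm y)\<^sup>2 - inner y (H y))" for s
  proof -
    have "0 \<le> m * (norm (v + s *\<^sub>R y))\<^sup>2 - inner (v + s *\<^sub>R y) (H (v + s *\<^sub>R y))"
      using bound[of "v + s *\<^sub>R y"] by simp
    also have "\<dots> = m * (norm v)\<^sup>2 - m + 2 * s * (m * inner v y - inner (H v) y) + s\<^sup>2 * (m * (norm y)\<^sup>2 - inner y (H y))"
      unfolding power2_norm_eq_inner
      by (simp add: m_def inner_add_left inner_add_right add scaleR vy inner_commute algebra_simps power2_eq_square)
    also have "m * inner v y - inner (H v) y = (norm y)\<^sup>2"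
      using inner_commute[of "H v" v]
      by (simp add: y_def power2_norm_eq_inner inner_diff_left inner_diff_right right_diff_distrib)
    finally show ?thesis using v by (simp add: algebra_simps)
  qed
  have "y = 0"
  proof (rule ccontr)
    assume "y \<noteq> 0"
    define P where "P = m * (norm y)\<^sup>2 - inner y (H y)"
    define Y where "Y = (norm y)\<^sup>2"
    have Y: "Y > 0" using \<open>y \<noteq> 0\<close> by (simp add: Y_def)
    have P: "P \<ge> 0" using bound[of y] by (simp add: P_def)
    \<comment> \<open>This negative \<open>s\<close> is small enough for the linear term to dominate
      the quadratic one; the denominator is positive because \<open>P\<close> is nonnegative and
      \<open>Y\<close> is positive.\<close>
    have "0 \<le> 2 * (- (Y / (P + Y))) * Y + (- (Y / (P + Y)))\<^sup>2 * P"
      using quad[of "- (Y / (P + Y))"] by (simp add: P_def Y_def)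
    also have "\<dots> = - (Y / (P + Y)) * Y * (2 - P / (P + Y))"
      by (simp add: power2_eq_square algebra_simps)
    also have "\<dots> < 0"
    proof -
      have "P / (P + Y) \<le> 1" "Y / (P + Y) > 0" using P Y by simp_all
      then have "Y / (P + Y) * Y * (2 - P / (P + Y)) > 0" using Y by (intro mult_pos_pos) auto
      then show ?thesis by simp
    qed
    finally show False by simp
  qed
  then have "H v = m *\<^sub>R v" by (simp add: y_def)
  then show ?thesis using that[of v m] v bound by fastforce
qed

section \<open>Hermitian parts and the augmented matrix\<close>

lemma inner_complex_vec: "inner x y = Re (\<Sum>i\<in>UNIV. cnj (x $ i) * y $ i)" for x y :: "complex^'n"
  by (simp add: inner_vec_def inner_complex_def)

lemma norm_scalar_mult_complex: "norm (c *s x) = cmod c * norm x" for x :: "complex^'n"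
  by (simp add: norm_vec_def norm_mult L2_set_right_distrib)

lemma of_real_scalar_mult: "complex_of_real r *s x = r *\<^sub>R x" for x :: "complex^'n"
  by (simp add: vec_eq_iff scaleR_conv_of_real[where 'a = complex])

lemma inner_adj: "inner (adj M *v x) y = inner x (M *v y)" for M :: "complex^'n^'m"
proof -
  have "(\<Sum>i\<in>UNIV. cnj ((adj M *v x) $ i) * y $ i) = (\<Sum>i\<in>UNIV. \<Sum>j\<in>UNIV. cnj (x $ j) * (M $ j $ i * y $ i))"
    by (simp add: matrix_vector_mult_def adj_def map_matrix_def transpose_def cnj_sum sum_distrib_right sum_distrib_left
        mult_ac)
  also have "\<dots> = (\<Sum>j\<in>UNIV. cnj (x $ j) * (M *v y) $ j)"
    by (subst sum.swap) (simp add: matrix_vector_mult_def sum_distrib_left)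
  finally show ?thesis by (simp only: inner_complex_vec)
qed

lemma herm1_mult: "herm1 M *v x = (1/2) *\<^sub>R (M *v x + adj M *v x)"
  by (simp add: vec_eq_iff herm1_def matrix_vector_mult_def scaleR_conv_of_real[where 'a = complex] sum_distrib_left
      distrib_left sum.distrib algebra_simps)

lemma herm2_mult: "\<i> *s (herm2 M *v x) = (1/2) *\<^sub>R (M *v x - adj M *v x)"
  by (simp add: vec_eq_iff herm2_def map_matrix_def matrix_vector_mult_def scaleR_conv_of_real[where 'a = complex] sum_distrib_left
      flip: sum_subtractf)
     (auto intro!: sum.cong simp: field_simps)

lemma inner_herm1: "inner (herm1 M *v x) y = inner x (herm1 M *v y)"
  using inner_adj[of M x y] inner_adj[of M y x]
  by (simp add: herm1_mult inner_add_left inner_add_right inner_commute)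

lemma inner_herm1_self: "inner x (herm1 M *v x) = inner x (M *v x)"
  using inner_adj[of M x x]
  by (simp add: herm1_mult inner_add_right inner_commute)

text \<open>The matrix involved is the skew-Hermitian part of \<open>M\<close>, so it is skew for
  the real inner product. This makes the zeroth-order term of the system drop out of the energy
  balance.\<close>

lemma inner_i_herm2_self: "inner x (\<i> *s (herm2 M *v x)) = 0"
  using inner_adj[of M x x]
  by (simp add: herm2_mult inner_diff_right inner_commute)

text \<open>Because of this splitting, exp(-p) y(t) solves the hyperbolic system whenever y' = M y:
  the derivative in \<open>p\<close> contributes the factor -1.\<close>

lemma herm1_plus_i_herm2: "herm1 M *v x + \<i> *s (herm2 M *v x) = M *v x"
  unfolding herm1_mult herm2_mult by (simp add: algebra_simps flip: scaleR_add_left)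

lemma bounded_linear_matrix_vector: "bounded_linear ((*v) M)" for M :: "complex^'n^'m"
  by simp

text \<open>The matrix of the homogeneous system for the pair of \<open>u\<close> and a constant
  vector. \<open>H1g\<close> and \<open>H2g\<close> are its Hermitian parts, so the general facts on
  \<open>herm1\<close> and \<open>herm2\<close> apply to them.\<close>

definition aug_mat :: "real \<Rightarrow> complex^'n^'n \<Rightarrow> complex^'n \<Rightarrow> complex^('n + 'n)^('n + 'n)" where
  "aug_mat g A b = block_mat A (map_matrix (\<lambda>z. of_real g * z) (diag_mat b)) 0 0"

lemma H1g_eq_herm1: "H1g g A b = herm1 (aug_mat g A b)"
  by (auto simp: vec_eq_iff H1g_def aug_mat_def herm1_def block_mat_def adj_def map_matrix_def
      transpose_def scaleR_conv_of_real[where 'a = complex] split: sum.splits)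

lemma H2g_eq_herm2: "H2g g A b = herm2 (aug_mat g A b)"
  by (auto simp: vec_eq_iff H2g_def aug_mat_def herm2_def block_mat_def adj_def map_matrix_def
      transpose_def split: sum.splits)

lemma sum_UNIV_sum: "(\<Sum>r\<in>(UNIV :: ('a::finite + 'b::finite) set). f r) = (\<Sum>i\<in>UNIV. f (Inl i)) + (\<Sum>i\<in>UNIV. f (Inr i))"
  by (simp add: sum.Plus flip: UNIV_Plus_UNIV)

lemma norm_block_vec: "(norm (block_vec x y))\<^sup>2 = (norm x)\<^sup>2 + (norm y)\<^sup>2" for x y :: "complex^'n"
  by (simp add: power2_norm_eq_inner inner_vec_def sum_UNIV_sum block_vec_def)

lemma norm_block_vec_le: "norm (block_vec x y) \<le> norm x + norm y" for x y :: "complex^'n"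
  by (rule power2_le_imp_le) (auto simp: norm_block_vec power2_sum)

lemma norm_le_block_vec:
  "norm x \<le> norm (block_vec x y)" "norm y \<le> norm (block_vec x y)" for x y :: "complex^'n"
  by (rule power2_le_imp_le; simp add: norm_block_vec)+

lemma block_vec_cases:
  fixes w :: "'a^('n::finite + 'n)"
  obtains x y where "w = block_vec x y"
proof
  show "w = block_vec (block_fst w) (\<chi> i. w $ Inr i)"
    by (auto simp: vec_eq_iff block_vec_def block_fst_def split: sum.splits)
qed

lemma block_fst_block_vec [simp]: "block_fst (block_vec x y) = x" for x y :: "'a^'n::finite"
  by (simp add: block_fst_def block_vec_def vec_eq_iff)

lemma norm_block_fst_le: "norm (block_fst w) \<le> norm w" for w :: "complex^('n::finite + 'n)"
  by (cases w rule: block_vec_cases) (simp add: norm_le_block_vec)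

lemma aug_mat_mult:
  "aug_mat g A b *v block_vec x y = block_vec (A *v x + (\<chi> i. of_real g * b $ i * y $ i)) 0"
proof -
  have "(aug_mat g A b *v block_vec x y) $ r = block_vec (A *v x + (\<chi> i. of_real g * b $ i * y $ i)) 0 $ r" for r
  proof (cases r)
    case (Inl i)
    have "(\<Sum>j\<in>UNIV. of_real g * (if i = j then b $ i else 0) * y $ j) = of_real g * b $ i * y $ i"
      by (simp add: if_distrib if_distribR cong: if_cong)
    then show ?thesis
      by (simp add: Inl matrix_vector_mult_def aug_mat_def block_mat_def block_vec_def sum_UNIV_sum map_matrix_def diag_mat_def)
  qed (simp add: matrix_vector_mult_def aug_mat_def block_mat_def block_vec_def sum_UNIV_sum)
  then show ?thesis by (simp add: vec_eq_iff)
qed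

lemma norm_cmul_components_le:
  fixes y :: "complex^'n"
  assumes "\<And>i. cmod (d i) \<le> \<beta>" "\<beta> \<ge> 0"
  shows "norm (\<chi> i. d i * y $ i) \<le> \<beta> * norm y"
proof -
  have "norm (\<chi> i. d i * y $ i) \<le> norm (\<beta> *\<^sub>R y)"
    unfolding norm_vec_def
    by (rule L2_set_mono) (use assms in \<open>auto simp: norm_mult intro: mult_right_mono\<close>)
  then show ?thesis using assms by simp
qed

lemma norm_aug_mat_le:
  fixes A :: "complex^'n^'n"
  assumes A: "\<And>x. norm (A *v x) \<le> \<alpha> * norm x" and \<alpha>: "\<alpha> \<ge> 0"
    and b: "\<And>i. cmod (of_real g * b $ i) \<le> \<beta>" and \<beta>: "\<beta> \<ge> 0"
  shows "norm (aug_mat g A b *v w) \<le> (\<alpha> + \<beta>) * norm w"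
proof (cases w rule: block_vec_cases)
  case (1 x y)
  have "norm (aug_mat g A b *v w) \<le> norm (A *v x + (\<chi> i. of_real g * b $ i * y $ i)) + norm (0 :: complex^'n)"
    unfolding 1 aug_mat_mult by (rule norm_block_vec_le)
  also have "\<dots> \<le> norm (A *v x) + norm (\<chi> i. of_real g * b $ i * y $ i)"
    by (simp add: norm_triangle_ineq)
  also have "\<dots> \<le> \<alpha> * norm x + \<beta> * norm y"
    by (intro add_mono A norm_cmul_components_le b \<beta>)
  also have "\<dots> \<le> \<alpha> * norm w + \<beta> * norm w"
    unfolding 1 by (intro add_mono mult_left_mono norm_le_block_vec \<alpha> \<beta>)
  finally show ?thesis by (simp add: algebra_simps)
qed

text \<open>The uniform bound on \<open>M\<close> makes the set of positive eigenvalues bounded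
  above, so the supremum is a genuine upper bound. The quadratic form is controlled by the largest
  eigenvalue of \<open>herm1 (M t)\<close>.\<close>

lemma lam_max_pos_upper:
  fixes M :: "real \<Rightarrow> complex^'n^'n"
  assumes bound: "\<And>t x. 0 < t \<Longrightarrow> t < T \<Longrightarrow> norm (M t *v x) \<le> \<Lambda> * norm x"
    and t: "0 < t" "t < T"
  shows "inner x (herm1 (M t) *v x) \<le> lam_max_pos T (\<lambda>t. herm1 (M t)) * (norm x)\<^sup>2"
    and "0 \<le> lam_max_pos T (\<lambda>t. herm1 (M t))"
proof -
  let ?X = "insert 0 {\<bar>x\<bar> | x s. 0 < s \<and> s < T \<and> complex_of_real x \<in> eigvals (herm1 (M s)) \<and> x > 0}"
  have "x \<le> \<Lambda>" if x: "0 < s" "s < T" "complex_of_real x \<in> eigvals (herm1 (M s))" for x s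
  proof -
    obtain v where v: "v \<noteq> 0" "herm1 (M s) *v v = x *\<^sub>R v"
      using x(3) by (auto simp: eigvals_def of_real_scalar_mult)
    have "x * (norm v)\<^sup>2 = inner v (M s *v v)"
      using inner_herm1_self[of v "M s"] by (simp add: v power2_norm_eq_inner)
    also have "\<dots> \<le> norm v * norm (M s *v v)" by (rule norm_cauchy_schwarz)
    also have "\<dots> \<le> norm v * (\<Lambda> * norm v)" by (intro mult_left_mono bound x) auto
    finally have "x * (norm v)\<^sup>2 \<le> \<Lambda> * (norm v)\<^sup>2" by (simp add: power2_eq_square algebra_simps)
    then show ?thesis using v by simp
  qed
  then have "\<forall>z\<in>?X. z \<le> max \<Lambda> 0" by fastforce
  then have bdd: "bdd_above ?X" by (meson bdd_above.I)
  then show nn: "0 \<le> lam_max_pos T (\<lambda>t. herm1 (M t))"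
    unfolding lam_max_pos_def by (intro cSup_upper) auto
  obtain v m where v: "v \<noteq> 0" "herm1 (M t) *v v = m *\<^sub>R v"
    and m: "\<And>x. inner x (herm1 (M t) *v x) \<le> m * (norm x)\<^sup>2"
    using symmetric_form_max_eigenvector[OF bounded_linear_matrix_vector inner_herm1] by blast
  \<comment> \<open>A positive largest eigenvalue belongs to the set; otherwise the inserted 0
    already dominates it.\<close>
  have "m \<le> lam_max_pos T (\<lambda>t. herm1 (M t))"
  proof (cases "m > 0")
    case True
    have "complex_of_real m \<in> eigvals (herm1 (M t))"
      using v by (auto simp: eigvals_def of_real_scalar_mult)
    then have "m \<in> ?X"
      using True t by (intro insertI2 CollectI exI[of _ m] exI[of _ t]) simp
    then show ?thesis unfolding lam_max_pos_def by (intro cSup_upper bdd)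
  qed (use nn in simp)
  then show "inner x (herm1 (M t) *v x) \<le> lam_max_pos T (\<lambda>t. herm1 (M t)) * (norm x)\<^sup>2"
    using m[of x] by (meson mult_right_mono order_trans zero_le_power2)
qed

section \<open>Trigonometric interpolation of the exponential\<close>

definition wave :: "real \<Rightarrow> nat \<Rightarrow> nat \<Rightarrow> real \<Rightarrow> complex" where
  "wave L N l p = exp (\<i> * of_real (mu L N l * (p + pi * L)))"

lemma Phi_eq_wave: "Phi L N j l = wave L N l (grid L N j)"
  by (simp add: Phi_def wave_def)

lemma has_vector_derivative_exp_i:
  "((\<lambda>p. exp (\<i> * of_real (w * (p + d)))) has_vector_derivative
      (\<i> * of_real w) * exp (\<i> * of_real (w * (p + d)))) (at p within S)"
proof -
  let ?f = "\<lambda>z. exp (\<i> * of_real w * (z + of_real d))"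
  have "(?f has_field_derivative (\<i> * of_real w) * ?f (of_real p)) (at (of_real p))"
    by (auto intro!: derivative_eq_intros)
  from has_vector_derivative_real_field[OF this] show ?thesis
    by (simp add: mult.assoc)
qed

lemma has_vector_derivative_wave:
  "(wave L N l has_vector_derivative (\<i> * of_real (mu L N l)) * wave L N l p) (at p within S)"
  unfolding wave_def[abs_def] by (rule has_vector_derivative_exp_i)

lemma continuous_on_wave [continuous_intros]: "continuous_on S (wave L N l)"
  unfolding wave_def[abs_def] by (intro continuous_intros)

lemma exp_mult_cnj_exp:
  "exp (\<i> * of_real x) * cnj (exp (\<i> * of_real y)) = exp (\<i> * of_real (x - y))"
  by (simp add: cis_conv_exp[symmetric] cis_cnj cis_mult del: of_real_diff)

lemma exp_i_two_pi_int: "exp (\<i> * of_real (2 * pi * of_int z)) = 1"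
  by (auto simp: exp_eq_1)

lemma mu_diff: "mu L N l - mu L N l' = (real l - real l') / L"
  by (simp add: mu_def diff_divide_distrib)

text \<open>For \<open>d\<close> nonzero with |d| < N the ratio is an \<open>N\<close>-th root of
  unity different from 1, so the geometric sum vanishes.\<close>

lemma geometric_sum_root_of_unity:
  fixes d :: int
  assumes "\<bar>d\<bar> < int N"
  shows "(\<Sum>k<N. exp (\<i> * of_real (2 * pi * of_int d * real k / real N))) = (if d = 0 then of_nat N else 0)"
proof (cases "d = 0")
  case False
  define z where "z = exp (\<i> * of_real (2 * pi * of_int d / real N))"
  have N: "N > 0" using assms by simp
  have pow: "exp (\<i> * of_real (2 * pi * of_int d * real k / real N)) = z ^ k" for k
    unfolding z_def by (simp add: field_simps flip: exp_of_nat_mult)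
  have "z ^ N = exp (2 * of_int d * of_real pi * \<i>)"
    using N by (simp add: pow[symmetric] algebra_simps)
  also have "\<dots> = 1" by (simp add: exp_eq_1 mult.commute)
  finally have zN: "z ^ N = 1" .
  have "z \<noteq> 1"
  proof
    assume "z = 1"
    then obtain n :: int where "2 * pi * of_int d / real N = of_int (2 * n) * pi"
      by (auto simp: z_def exp_eq_1)
    then have "real_of_int d = of_int (n * int N)" using N by (simp add: field_simps)
    then have "d = n * int N" by (simp only: of_int_eq_iff)
    with assms False show False
      by (simp add: abs_mult)
  qed
  then show ?thesis using zN False by (simp only: pow geometric_sum[OF \<open>z \<noteq> 1\<close>]) simp
qed simp

lemma grid_shift: "N > 0 \<Longrightarrow> L > 0 \<Longrightarrow> mu L N l * (grid L N k + pi * L) = 2 * pi * (real l - real N / 2) * real k / real N"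
  by (simp add: mu_def grid_def dp_def field_simps)

lemma Phi_columns_orthogonal:
  assumes N: "N > 0" "L > 0" and "l < N" "l' < N"
  shows "(\<Sum>k<N. Phi L N k l * cnj (Phi L N k l')) = (if l = l' then of_nat N else 0)"
proof -
  have "Phi L N k l * cnj (Phi L N k l') = exp (\<i> * of_real (2 * pi * of_int (int l - int l') * real k / real N))" for k
  proof -
    have "2 * pi * (real l - real N / 2) * real k / real N - 2 * pi * (real l' - real N / 2) * real k / real N =
        2 * pi * of_int (int l - int l') * real k / real N"
      by (simp add: algebra_simps diff_divide_distrib)
    then show ?thesis
      unfolding Phi_def exp_mult_cnj_exp grid_shift[OF N] by (simp only:)
  qed
  then show ?thesis
    using geometric_sum_root_of_unity[of "int l - int l'" N] assms by auto
qed

lemma Phi_rows_orthogonal: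
  assumes N: "N > 0" "L > 0" and "k < N" "k' < N"
  shows "(\<Sum>l<N. Phi L N k l * cnj (Phi L N k' l)) = (if k = k' then of_nat N else 0)"
proof -
  \<comment> \<open>The shift of the frequencies by \<open>N / 2\<close> leaves a phase independent
    of \<open>l\<close>; it equals 1 on the diagonal.\<close>
  define c where "c = exp (- (\<i> * of_real (pi * (real k - real k'))))"
  have "Phi L N k l * cnj (Phi L N k' l) = c * exp (\<i> * of_real (2 * pi * of_int (int k - int k') * real l / real N))" for l
  proof -
    have "2 * pi * (real l - real N / 2) * real k / real N - 2 * pi * (real l - real N / 2) * real k' / real N =
        - (pi * (real k - real k')) + 2 * pi * of_int (int k - int k') * real l / real N"
      using N by (simp add: field_simps)
    then show ?thesis
      unfolding Phi_def exp_mult_cnj_exp grid_shift[OF N] c_def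
      by (simp only: distrib_left of_real_add exp_add of_real_minus mult_minus_right)
  qed
  then have "(\<Sum>l<N. Phi L N k l * cnj (Phi L N k' l)) = c * (if k = k' then of_nat N else 0)"
    using geometric_sum_root_of_unity[of "int k - int k'" N] assms by (simp flip: sum_distrib_left)
  then show ?thesis by (simp add: c_def)
qed

text \<open>\<open>inv_N\<close> is a choice, so some inverse has to be exhibited. By the two
  orthogonality relations the conjugate transpose of \<open>Phi\<close> divided by \<open>N\<close>
  is one.\<close>

lemma inv_N_Phi:
  assumes N: "N > 0" "L > 0" and "i < N" "j < N"
  shows "(\<Sum>k<N. Phi L N i k * inv_N N (Phi L N) k j) = id_N i j"
proof -
  have "\<exists>M'. \<forall>i<N. \<forall>j<N. (\<Sum>k<N. Phi L N i k * M' k j) = id_N i j \<and> (\<Sum>k<N. M' i k * Phi L N k j) = id_N i j"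
  proof (intro exI allI impI conjI)
    fix i j assume ij: "i < N" "j < N"
    have "(\<Sum>k<N. Phi L N i k * (cnj (Phi L N j k) / of_nat N)) = (\<Sum>k<N. Phi L N i k * cnj (Phi L N j k)) / of_nat N"
      by (simp add: sum_divide_distrib)
    then show "(\<Sum>k<N. Phi L N i k * (\<lambda>k j. cnj (Phi L N j k) / of_nat N) k j) = id_N i j"
      using N Phi_rows_orthogonal[OF N ij] by (simp add: id_N_def)
    have "(\<Sum>k<N. cnj (Phi L N k i) / of_nat N * Phi L N k j) = (\<Sum>k<N. Phi L N k j * cnj (Phi L N k i)) / of_nat N"
      by (simp add: sum_divide_distrib mult.commute)
    then show "(\<Sum>k<N. (\<lambda>k j. cnj (Phi L N j k) / of_nat N) i k * Phi L N k j) = id_N i j"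
      using N Phi_columns_orthogonal[OF N ij(2,1)] by (auto simp: id_N_def)
  qed
  from someI_ex[OF this] show ?thesis
    unfolding inv_N_def using assms(3,4) by blast
qed

lemma cmod_sum_sq:
  "complex_of_real ((cmod (\<Sum>l\<in>I. x l))\<^sup>2) = (\<Sum>l\<in>I. \<Sum>l'\<in>I. x l * cnj (x l'))"
  unfolding complex_norm_square by (simp add: cnj_sum sum_product)

lemma discrete_parseval:
  assumes N: "N > 0" "L > 0"
  shows "(\<Sum>k<N. (cmod (\<Sum>l<N. a l * Phi L N k l))\<^sup>2) = real N * (\<Sum>l<N. (cmod (a l))\<^sup>2)"
proof -
  have "complex_of_real (\<Sum>k<N. (cmod (\<Sum>l<N. a l * Phi L N k l))\<^sup>2) =
      (\<Sum>k<N. \<Sum>l<N. \<Sum>l'<N. (a l * cnj (a l')) * (Phi L N k l * cnj (Phi L N k l')))"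
    unfolding of_real_sum cmod_sum_sq by (simp add: mult_ac)
  also have "\<dots> = (\<Sum>l<N. \<Sum>l'<N. \<Sum>k<N. (a l * cnj (a l')) * (Phi L N k l * cnj (Phi L N k l')))"
    by (subst sum.swap, rule sum.cong[OF refl], rule sum.swap)
  also have "\<dots> = (\<Sum>l<N. \<Sum>l'<N. if l' = l then a l * cnj (a l') * of_nat N else 0)"
    using Phi_columns_orthogonal[OF N] by (intro sum.cong refl) (auto simp flip: sum_distrib_left)
  also have "\<dots> = complex_of_real (real N * (\<Sum>l<N. (cmod (a l))\<^sup>2))"
    by (simp add: complex_norm_square[symmetric] sum_distrib_left mult.commute
        flip: of_real_power)
  finally show ?thesis by (simp only: of_real_eq_iff)
qed

text \<open>Any number \<open>m\<close> of full periods is allowed, because the interval needed by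
  the energy argument may be longer than one period when \<open>L\<close> is small.\<close>

lemma integral_parseval:
  assumes N: "L > 0"
  shows "((\<lambda>p. (cmod (\<Sum>l<N. a l * wave L N l p))\<^sup>2) has_integral
      (2 * pi * L * real m) * (\<Sum>l<N. (cmod (a l))\<^sup>2)) {0..2 * pi * L * real m}"
proof -
  let ?P = "2 * pi * L * real m"
  have P: "?P \<ge> 0" using N by simp
  have orth: "((\<lambda>p. wave L N l p * cnj (wave L N l' p)) has_integral (if l' = l then of_real ?P else 0)) {0..?P}"
    for l l'
  proof -
    define w where "w = (real l - real l') / L"
    have eq: "wave L N l p * cnj (wave L N l' p) = exp (\<i> * of_real (w * (p + pi * L)))" for p
    proof -
      have "mu L N l * (p + pi * L) - mu L N l' * (p + pi * L) = w * (p + pi * L)"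
        unfolding w_def mu_diff[of L N, symmetric] by (simp add: algebra_simps)
      then show ?thesis unfolding wave_def exp_mult_cnj_exp by simp
    qed
    show ?thesis
    proof (cases "l' = l")
      case True
      have "((\<lambda>p. 1 :: complex) has_integral of_real ?P) {0..?P}"
        using has_integral_const_real[of "1::complex" 0 ?P] P by (simp add: scaleR_conv_of_real)
      moreover have "wave L N l p * cnj (wave L N l' p) = 1" for p
        unfolding eq using True by (simp add: w_def)
      ultimately show ?thesis using True by simp
    next
      case False
      then have w: "w \<noteq> 0" using N by (simp add: w_def)
      let ?F = "\<lambda>p. 1 / (\<i> * of_real w) * exp (\<i> * of_real (w * (p + pi * L)))"
      have I: "((\<lambda>p. exp (\<i> * of_real (w * (p + pi * L)))) has_integral ?F ?P - ?F 0) {0..?P}"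
      proof (rule fundamental_theorem_of_calculus[OF P])
        fix p
        show "(?F has_vector_derivative exp (\<i> * of_real (w * (p + pi * L)))) (at p within {0..?P})"
          using has_vector_derivative_mult_right[OF has_vector_derivative_exp_i[of w "pi * L"], of "1 / (\<i> * of_real w)" p "{0..?P}"] w
          by simp
      qed
      \<comment> \<open>The frequency difference is an integer multiple of \<open>1 / L\<close>, so
        the phase advances by a multiple of 2 pi over \<open>m\<close> periods.\<close>
      have "?F ?P = ?F 0"
      proof -
        have "w * (?P + pi * L) = w * (pi * L) + 2 * pi * of_int ((int l - int l') * int m)"
          using N by (simp add: w_def field_simps)
        then have "exp (\<i> * of_real (w * (?P + pi * L))) =
            exp (\<i> * of_real (w * (pi * L))) * exp (\<i> * of_real (2 * pi * of_int ((int l - int l') * int m)))"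
          by (simp only: of_real_add distrib_left exp_add)
        also have "\<dots> = exp (\<i> * of_real (w * (pi * L)))"
          by (simp only: exp_i_two_pi_int mult_1_right)
        finally show ?thesis by simp
      qed
      then have "?F ?P - ?F 0 = 0" by (simp only: diff_self)
      then show ?thesis using I False by (simp only: eq if_False)
    qed
  qed
  have "((\<lambda>p. \<Sum>l<N. \<Sum>l'<N. (a l * cnj (a l')) * (wave L N l p * cnj (wave L N l' p))) has_integral
      (\<Sum>l<N. \<Sum>l'<N. (a l * cnj (a l')) * (if l' = l then of_real ?P else 0))) {0..?P}"
    by (intro has_integral_sum has_integral_mult_right orth) auto
  moreover have "(\<Sum>l<N. \<Sum>l'<N. (a l * cnj (a l')) * (wave L N l p * cnj (wave L N l' p))) =
      complex_of_real ((cmod (\<Sum>l<N. a l * wave L N l p))\<^sup>2)" for p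
    unfolding cmod_sum_sq by (simp add: mult_ac)
  moreover have "(\<Sum>l<N. \<Sum>l'<N. (a l * cnj (a l')) * (if l' = l then of_real ?P else 0)) =
     complex_of_real (?P * (\<Sum>l<N. (cmod (a l))\<^sup>2))"
    by (simp add: if_distrib complex_norm_square[symmetric] sum_distrib_left mult.commute
        flip: of_real_power cong: if_cong)
  ultimately have "((\<lambda>p. complex_of_real ((cmod (\<Sum>l<N. a l * wave L N l p))\<^sup>2)) has_integral
     complex_of_real (?P * (\<Sum>l<N. (cmod (a l))\<^sup>2))) {0..?P}" by simp
  from has_integral_linear[OF this bounded_linear_Re] show ?thesis by (simp add: o_def)
qed

text \<open>In the fourth-order Taylor formula the remainder is at most \<theta>^4 / 24, and
  \<theta>^4 is at most 10 \<theta>^2 because pi^2 < 10. The constant comes from 1/2 - 10/24 =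
  1/12.\<close>

lemma cos_le_quadratic:
  assumes "\<bar>\<theta>\<bar> \<le> pi"
  shows "cos \<theta> \<le> 1 - \<theta>\<^sup>2 / 12"
proof -
  obtain t where t: "cos \<theta> = (\<Sum>m<4. cos_coeff m * \<theta> ^ m) + (cos (t + 1/2 * real 4 * pi) / fact 4) * \<theta> ^ 4"
    using Maclaurin_cos_expansion[of \<theta> 4] by auto
  have "(\<Sum>m<4. cos_coeff m * \<theta> ^ m) = 1 - \<theta>\<^sup>2 / 2"
  proof -
    have "{..<4::nat} = {0, 1, 2, 3}" by auto
    then show ?thesis by (simp add: cos_coeff_def)
  qed
  moreover have "(cos (t + 1/2 * real 4 * pi) / fact 4) * \<theta> ^ 4 \<le> 1 / 24 * \<theta> ^ 4"
    by (intro mult_right_mono) (simp_all add: fact_numeral)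
  moreover have "\<theta> ^ 4 \<le> 10 * \<theta>\<^sup>2"
  proof -
    have "\<theta>\<^sup>2 \<le> pi\<^sup>2" using assms abs_le_square_iff[of \<theta> pi] by simp
    also have "pi\<^sup>2 \<le> (3.15)\<^sup>2" using pi_approx by (intro power_mono) auto
    also have "\<dots> \<le> (10::real)" by (simp add: power2_eq_square)
    finally have "\<theta>\<^sup>2 * \<theta>\<^sup>2 \<le> 10 * \<theta>\<^sup>2" by (intro mult_right_mono) auto
    then show ?thesis by (simp add: eval_nat_numeral)
  qed
  ultimately show ?thesis using t by linarith
qed

lemma cmod_exp_minus_one_ge:
  assumes "\<bar>\<theta>\<bar> \<le> pi"
  shows "\<theta>\<^sup>2 / 6 \<le> (cmod (exp (\<i> * of_real \<theta>) - 1))\<^sup>2"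
proof -
  have "(cmod (exp (\<i> * of_real \<theta>) - 1))\<^sup>2 = (cos \<theta> - 1)\<^sup>2 + (sin \<theta>)\<^sup>2"
    by (simp add: cis_conv_exp[symmetric] cmod_power2)
  also have "\<dots> = 2 - 2 * cos \<theta>"
    by (simp add: power2_diff sin_squared_eq)
  finally show ?thesis using cos_le_quadratic[OF assms] by simp
qed

text \<open>The running total variation of \<open>exp (- \<bar>p\<bar>)\<close>, written in closed form.\<close>

definition exp_abs_variation :: "real \<Rightarrow> real" where
  "exp_abs_variation p = (if p \<le> 0 then exp p else 2 - exp (- p))"

text \<open>The exponential has slope at most 1 on the nonpositive half-line. The positive half-line
  follows by reflection, and an interval containing 0 is split there.\<close>

lemma exp_abs_variation_diff:
  assumes "x \<le> y"
  shows "\<bar>exp (- \<bar>y\<bar>) - exp (- \<bar>x\<bar>)\<bar> \<le> exp_abs_variation y - exp_abs_variation x"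
    and "exp_abs_variation y - exp_abs_variation x \<le> y - x"
proof -
  have lip: "exp b - exp a \<le> b - a" if "a \<le> b" "b \<le> 0" for a b :: real
  proof -
    have "exp b - exp a = exp b * (1 - exp (a - b))" by (simp add: right_diff_distrib flip: exp_add)
    also have "\<dots> \<le> 1 * (b - a)"
    proof (intro mult_mono)
      show "1 - exp (a - b) \<le> b - a" using exp_ge_add_one_self[of "a - b"] by linarith
    qed (use that in auto)
    finally show ?thesis by simp
  qed
  consider "y \<le> 0" | "x \<le> 0" "0 < y" | "0 < x" using assms by linarith
  then show "\<bar>exp (- \<bar>y\<bar>) - exp (- \<bar>x\<bar>)\<bar> \<le> exp_abs_variation y - exp_abs_variation x"
    using assms by cases (auto simp: exp_abs_variation_def abs_if)
  show "exp_abs_variation y - exp_abs_variation x \<le> y - x"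
    using assms lip[of x y] lip[of "-y" "-x"] lip[of x 0] lip[of "-y" 0]
    by (auto simp: exp_abs_variation_def)
qed

lemma exp_abs_variation_bounds: "0 \<le> exp_abs_variation p" "exp_abs_variation p \<le> 2"
  by (auto simp: exp_abs_variation_def) (smt (verit) exp_le_one_iff)+

section \<open>Square-integral bounds\<close>

lemma norm_diff_sq_le: "(norm (x - y))\<^sup>2 \<le> 2 * (norm x)\<^sup>2 + 2 * (norm y)\<^sup>2" for x y :: complex
proof -
  have "(norm (x - y))\<^sup>2 \<le> (norm x + norm y)\<^sup>2"
    by (intro power_mono norm_triangle_ineq4) auto
  also have "\<dots> \<le> 2 * (norm x)\<^sup>2 + 2 * (norm y)\<^sup>2"
    using zero_le_power2[of "norm x - norm y"] by (simp add: power2_diff power2_sum)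
  finally show ?thesis .
qed

lemma integral_diff_sq_le:
  fixes f g :: "real \<Rightarrow> complex"
  assumes "continuous_on {a..b} f" "continuous_on {a..b} g"
  shows "integral {a..b} (\<lambda>p. (norm (f p - g p))\<^sup>2) \<le>
    2 * integral {a..b} (\<lambda>p. (norm (f p))\<^sup>2) + 2 * integral {a..b} (\<lambda>p. (norm (g p))\<^sup>2)"
proof -
  have i: "(\<lambda>p. (norm (f p))\<^sup>2) integrable_on {a..b}" "(\<lambda>p. (norm (g p))\<^sup>2) integrable_on {a..b}"
    by (intro integrable_continuous_real continuous_intros assms)+
  have "integral {a..b} (\<lambda>p. (norm (f p - g p))\<^sup>2) \<le>
      integral {a..b} (\<lambda>p. 2 * (norm (f p))\<^sup>2 + 2 * (norm (g p))\<^sup>2)"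
    by (intro integral_le norm_diff_sq_le integrable_continuous_real continuous_intros assms)
  also have "\<dots> = 2 * integral {a..b} (\<lambda>p. (norm (f p))\<^sup>2) + 2 * integral {a..b} (\<lambda>p. (norm (g p))\<^sup>2)"
    using i by (subst integral_add) (auto intro: integrable_on_mult_right)
  finally show ?thesis .
qed

lemma integral_exp_sq_le:
  assumes "M \<ge> 0"
  shows "integral {0..M} (\<lambda>p. (norm (complex_of_real (exp (- p))))\<^sup>2) \<le> 1"
proof -
  have "((\<lambda>p. (exp (- p))\<^sup>2) has_integral (- exp (- 2 * M) / 2 - (- exp (- 2 * 0) / 2))) {0..M}"
  proof (rule fundamental_theorem_of_calculus[OF assms])
    fix p
    show "((\<lambda>p. - exp (- 2 * p) / 2) has_vector_derivative (exp (- p))\<^sup>2) (at p within {0..M})"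
      unfolding has_real_derivative_iff_has_vector_derivative[symmetric]
      by (auto intro!: derivative_eq_intros simp: power2_eq_square simp flip: exp_add)
  qed
  then have "integral {0..M} (\<lambda>p. (exp (- p))\<^sup>2) = 1/2 - exp (- 2 * M) / 2"
    by (simp add: integral_unique)
  also have "\<dots> \<le> 1" using exp_ge_zero[of "- 2 * M"] by linarith
  finally show ?thesis by (simp add: norm_of_real)
qed

section \<open>The trigonometric interpolant of exp(-|p|) and its error on the positive side\<close>

locale trig_interpolant =
  fixes L :: real and N :: nat and c :: "nat \<Rightarrow> complex"
  assumes L: "L > 0" and N: "N > 0" and even: "even N"
    and interp: "\<And>k. k < N \<Longrightarrow> (\<Sum>l<N. c l * Phi L N k l) = psi_h L N k"
begin

definition S :: "real \<Rightarrow> complex" where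
  "S p = (\<Sum>l<N. c l * wave L N l p)"

lemma dp_pos: "dp L N > 0"
  using L N by (simp add: dp_def)

lemma N_dp: "real N * dp L N = 2 * pi * L"
  using N by (simp add: dp_def)

lemma grid_Suc: "grid L N (Suc k) = grid L N k + dp L N"
  by (simp add: grid_def distrib_right)

text \<open>The case \<open>k = N\<close> is the right end \<open>pi * L\<close>, which is not an
  interpolation node. It is reached by periodicity, as evenness of \<open>N\<close> makes every
  \<mu>_l an integer multiple of \<open>1 / L\<close>, and by the symmetry of exp(-|p|).\<close>

lemma S_grid: "k \<le> N \<Longrightarrow> S (grid L N k) = of_real (exp (- \<bar>grid L N k\<bar>))"
proof (cases "k = N")
  case True
  have "wave L N l (grid L N N) = wave L N l (grid L N 0)" for l
  proof -
    obtain M where M: "N = 2 * M" using even by auto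
    have "grid L N N + pi * L = 2 * pi * L" by (simp add: grid_def N_dp)
    moreover have "mu L N l * (2 * pi * L) = 2 * pi * of_int (int l - int M)"
      using L by (simp add: mu_def M)
    ultimately have "wave L N l (grid L N N) = 1"
      unfolding wave_def by (simp only: exp_i_two_pi_int)
    then show ?thesis by (simp add: wave_def grid_def)
  qed
  then have "S (grid L N N) = S (grid L N 0)" by (simp add: S_def)
  also have "\<dots> = psi_h L N 0" using interp[of 0] N by (simp add: S_def Phi_eq_wave)
  also have "\<dots> = of_real (exp (- \<bar>grid L N N\<bar>))"
    by (simp add: psi_h_def grid_def N_dp mult.commute)
  finally show ?thesis using True by simp
next
  case False
  then show "k \<le> N \<Longrightarrow> ?thesis" using interp[of k] by (simp add: S_def Phi_eq_wave psi_h_def)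
qed

lemma sum_coeff_le: "(\<Sum>l<N. (cmod (c l))\<^sup>2) \<le> 1"
proof -
  have "real N * (\<Sum>l<N. (cmod (c l))\<^sup>2) = (\<Sum>k<N. (cmod (psi_h L N k))\<^sup>2)"
    using discrete_parseval[OF N L, of c] interp by simp
  also have "\<dots> \<le> (\<Sum>k<N. 1)"
    by (intro sum_mono) (simp add: psi_h_def power_le_one)
  finally show ?thesis using N by simp
qed

text \<open>A forward difference multiplies the coefficient with index \<open>l\<close> by
  \<open>exp (\<i> \<mu>\<^sub>l \<triangle>p) - 1\<close>, which has modulus comparable to \<open>\<bar>\<mu>\<^sub>l\<bar> \<triangle>p\<close> because
  \<open>\<bar>\<mu>\<^sub>l\<bar> \<triangle>p \<le> \<pi>\<close>. So the derivative of the interpolant is controlled by the variation of the data.\<close>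

lemma sum_mu_coeff_le: "2 * pi * L * (\<Sum>l<N. (cmod (\<i> * of_real (mu L N l) * c l))\<^sup>2) \<le> 12"
proof -
  define h where "h = dp L N"
  define a where "a l = c l * (exp (\<i> * of_real (mu L N l * h)) - 1)" for l
  \<comment> \<open>For \<open>k = N - 1\<close> the difference reaches the right end, so the extra
    node of \<open>S_grid\<close> is needed.\<close>
  have diff: "(\<Sum>l<N. a l * Phi L N k l) = of_real (exp (- \<bar>grid L N (Suc k)\<bar>) - exp (- \<bar>grid L N k\<bar>))"
    if k: "k < N" for k
  proof -
    have "wave L N l (grid L N (Suc k)) = exp (\<i> * of_real (mu L N l * h)) * wave L N l (grid L N k)" for l
      unfolding wave_def grid_Suc h_def exp_add[symmetric] by (simp add: algebra_simps)
    then have "(\<Sum>l<N. a l * Phi L N k l) = S (grid L N (Suc k)) - S (grid L N k)"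
      by (simp add: S_def a_def Phi_eq_wave algebra_simps flip: sum_subtractf)
    then show ?thesis using k by (simp add: S_grid)
  qed
  have "real N * (\<Sum>l<N. (cmod (a l))\<^sup>2) =
      (\<Sum>k<N. (exp (- \<bar>grid L N (Suc k)\<bar>) - exp (- \<bar>grid L N k\<bar>))\<^sup>2)"
    unfolding discrete_parseval[OF N L, of a, symmetric]
    by (intro sum.cong refl) (simp add: diff norm_of_real del: of_real_diff)
  \<comment> \<open>One factor of each square is bounded by \<open>h\<close>, the other by the
    increment of the variation. The sum then telescopes to at most \<open>2 * h\<close>, and the
    factor 6 from \<open>cmod_exp_minus_one_ge\<close> gives the final 12.\<close>
  also have "\<dots> \<le> (\<Sum>k<N. h * (exp_abs_variation (grid L N (Suc k)) - exp_abs_variation (grid L N k)))"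
  proof (intro sum_mono)
    fix k
    let ?d = "\<bar>exp (- \<bar>grid L N (Suc k)\<bar>) - exp (- \<bar>grid L N k\<bar>)\<bar>"
    have le: "grid L N k \<le> grid L N (Suc k)" using dp_pos by (simp add: grid_Suc)
    have "?d * ?d \<le> h * (exp_abs_variation (grid L N (Suc k)) - exp_abs_variation (grid L N k))"
      using exp_abs_variation_diff[OF le] dp_pos
      by (intro mult_mono) (auto simp: grid_Suc h_def)
    then show "(exp (- \<bar>grid L N (Suc k)\<bar>) - exp (- \<bar>grid L N k\<bar>))\<^sup>2 \<le>
        h * (exp_abs_variation (grid L N (Suc k)) - exp_abs_variation (grid L N k))"
      by (simp add: power2_eq_square)
  qed
  also have "\<dots> = h * (exp_abs_variation (grid L N N) - exp_abs_variation (grid L N 0))"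
    using sum_lessThan_telescope[of "\<lambda>k. exp_abs_variation (grid L N k)" N]
    by (simp flip: sum_distrib_left)
  also have "\<dots> \<le> h * 2"
    using dp_pos exp_abs_variation_bounds(1)[of "grid L N 0"] exp_abs_variation_bounds(2)[of "grid L N N"]
    by (intro mult_left_mono) (auto simp: h_def)
  finally have 1: "real N * (\<Sum>l<N. (cmod (a l))\<^sup>2) \<le> h * 2" .
  have "h\<^sup>2 / 6 * (cmod (\<i> * of_real (mu L N l) * c l))\<^sup>2 \<le> (cmod (a l))\<^sup>2" if "l < N" for l
  proof -
    have "mu L N l * h = (2 * real l - real N) * pi / real N"
      using L N by (simp add: mu_def h_def dp_def field_simps)
    then have "\<bar>mu L N l * h\<bar> = \<bar>2 * real l - real N\<bar> * pi / real N"
      by (simp add: abs_mult)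
    also have "\<dots> \<le> real N * pi / real N"
      using that by (intro divide_right_mono mult_right_mono) auto
    finally have "(mu L N l * h)\<^sup>2 / 6 \<le> (cmod (exp (\<i> * of_real (mu L N l * h)) - 1))\<^sup>2"
      using N by (intro cmod_exp_minus_one_ge) simp
    then have "(cmod (c l))\<^sup>2 * ((mu L N l * h)\<^sup>2 / 6) \<le> (cmod (c l))\<^sup>2 * (cmod (exp (\<i> * of_real (mu L N l * h)) - 1))\<^sup>2"
      by (intro mult_left_mono) auto
    then show ?thesis
      by (simp add: a_def norm_mult power_mult_distrib mult_ac)
  qed
  then have "h\<^sup>2 / 6 * (\<Sum>l<N. (cmod (\<i> * of_real (mu L N l) * c l))\<^sup>2) \<le> (\<Sum>l<N. (cmod (a l))\<^sup>2)"
    unfolding sum_distrib_left by (intro sum_mono) auto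
  then have "real N * (h\<^sup>2 / 6 * (\<Sum>l<N. (cmod (\<i> * of_real (mu L N l) * c l))\<^sup>2)) \<le> h * 2"
    using 1 N by (meson mult_left_mono of_nat_0_le_iff order_trans)
  then have "h * (real N * h * (\<Sum>l<N. (cmod (\<i> * of_real (mu L N l) * c l))\<^sup>2)) \<le> h * 12"
    by (simp add: power2_eq_square mult_ac)
  then have "real N * h * (\<Sum>l<N. (cmod (\<i> * of_real (mu L N l) * c l))\<^sup>2) \<le> 12"
    using dp_pos by (simp add: h_def)
  then show ?thesis unfolding h_def N_dp .
qed

definition S' :: "real \<Rightarrow> complex" where
  "S' p = (\<Sum>l<N. (\<i> * of_real (mu L N l) * c l) * wave L N l p)"

lemma S_deriv: "(S has_vector_derivative S' p) (at p within X)"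
proof -
  have "(S has_vector_derivative (\<Sum>l<N. c l * ((\<i> * of_real (mu L N l)) * wave L N l p))) (at p within X)"
    unfolding S_def[abs_def]
    by (intro has_vector_derivative_sum has_vector_derivative_mult_right has_vector_derivative_wave)
  then show ?thesis by (simp add: S'_def mult_ac)
qed

lemma continuous_S: "continuous_on X S" and continuous_S': "continuous_on X S'"
  unfolding S_def[abs_def] S'_def[abs_def] by (intro continuous_intros)+

lemma integral_S'_le: "integral {0..pi * L} (\<lambda>p. (norm (S' p))\<^sup>2) \<le> 12"
proof -
  have "integral {0..pi * L} (\<lambda>p. (norm (S' p))\<^sup>2) \<le> integral {0..2 * pi * L * real 1} (\<lambda>p. (norm (S' p))\<^sup>2)"
    using L by (intro integral_subset_le integrable_continuous_real continuous_intros continuous_S') auto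
  also have "\<dots> = 2 * pi * L * (\<Sum>l<N. (cmod (\<i> * of_real (mu L N l) * c l))\<^sup>2)"
    using integral_unique[OF integral_parseval[OF L, where m = 1 and a = "\<lambda>l. \<i> * of_real (mu L N l) * c l"]]
    by (simp add: S'_def)
  finally show ?thesis using sum_mu_coeff_le by linarith
qed

text \<open>The least number of whole periods covering \<open>{0..M}\<close> has total length at
  most M + 2 pi L, which is below 3 M; on whole periods Parseval applies.\<close>

lemma integral_S_le:
  assumes M: "pi * L < M"
  shows "integral {0..M} (\<lambda>p. (norm (S p))\<^sup>2) \<le> 3 * M"
proof -
  define m where "m = nat \<lceil>M / (2 * pi * L)\<rceil>"
  have pL: "2 * pi * L > 0" using L by simp
  have M0: "M > 0" using M L by (meson mult_pos_pos order_less_trans pi_gt_zero)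
  have "0 < M / (2 * pi * L)" using M0 pL by (rule divide_pos_pos)
  then have m: "M / (2 * pi * L) \<le> real m" "real m \<le> M / (2 * pi * L) + 1"
    unfolding m_def by linarith+
  have m1: "M \<le> 2 * pi * L * real m"
    using m(1) pL by (simp add: pos_divide_le_eq mult.commute)
  have "2 * pi * L * real m \<le> 2 * pi * L * (M / (2 * pi * L) + 1)"
    using m(2) pL by (intro mult_left_mono) auto
  also have "\<dots> = M + 2 * pi * L" using L by (simp add: field_simps)
  finally have m2: "2 * pi * L * real m \<le> 3 * M" using M by simp
  have "integral {0..M} (\<lambda>p. (norm (S p))\<^sup>2) \<le> integral {0..2 * pi * L * real m} (\<lambda>p. (norm (S p))\<^sup>2)"
    using m1 by (intro integral_subset_le integrable_continuous_real continuous_intros continuous_S) auto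
  also have "\<dots> = 2 * pi * L * real m * (\<Sum>l<N. (cmod (c l))\<^sup>2)"
    using integral_unique[OF integral_parseval[OF L, where m = m and a = c]]
    by (simp add: S_def)
  also have "\<dots> \<le> 2 * pi * L * real m * 1"
    using pL by (intro mult_left_mono sum_coeff_le) auto
  finally show ?thesis using m2 by simp
qed

text \<open>Since \<open>N\<close> is even, 0 is a node, and from there on exp(-p) agrees with the
  interpolated data. The error vanishes at the left node of every cell, so the Poincare inequality
  on each cell and induction over the cells give the factor \<open>(dp L N)\<^sup>2\<close>.\<close>

lemma interpolation_error_le:
  "integral {0..pi * L} (\<lambda>p. (norm (S p - of_real (exp (- p))))\<^sup>2) \<le> 26 * (dp L N)\<^sup>2"
proof -
  define e where "e p = S p - of_real (exp (- p))" for p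
  define e' where "e' p = S' p - of_real (- exp (- p))" for p
  obtain M where M: "N = 2 * M" using even by auto
  have grid0: "grid L N M = 0" using N_dp by (simp add: grid_def M)
  have gridN: "grid L N N = pi * L" using N_dp by (simp add: grid_def)
  have e_deriv: "(e has_vector_derivative e' p) (at p within X)" for p X
  proof -
    have "((\<lambda>p. complex_of_real (exp (- p))) has_vector_derivative complex_of_real (- exp (- p))) (at p within X)"
      by (intro has_vector_derivative_of_real) (auto intro!: derivative_eq_intros)
    then show ?thesis unfolding e_def[abs_def] e'_def
      by (intro has_vector_derivative_diff S_deriv)
  qed
  have cont_e': "continuous_on X e'" for X
    unfolding e'_def[abs_def] by (intro continuous_intros continuous_S')
  have cont_e: "continuous_on X e" for X
    unfolding e_def[abs_def] by (intro continuous_intros continuous_S)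
  have i: "(\<lambda>p. (norm (e p))\<^sup>2) integrable_on {a..b}" "(\<lambda>p. (norm (e' p))\<^sup>2) integrable_on {a..b}" for a b
    by (intro integrable_continuous_real continuous_intros cont_e cont_e')+
  have "M + j \<le> N \<Longrightarrow> integral {0..grid L N (M + j)} (\<lambda>p. (norm (e p))\<^sup>2) \<le>
      (dp L N)\<^sup>2 * integral {0..grid L N (M + j)} (\<lambda>p. (norm (e' p))\<^sup>2)" for j
  proof (induction j)
    case 0
    then show ?case by (simp add: grid0)
  next
    case (Suc j)
    let ?x = "grid L N (M + j)" and ?y = "grid L N (M + Suc j)"
    have xy: "?y = ?x + dp L N" by (simp add: grid_Suc)
    have "?x = grid L N M + real j * dp L N" by (simp add: grid_def distrib_right)
    then have x0: "0 \<le> ?x" using dp_pos grid0 by simp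
    have "integral {?x..?y} (\<lambda>p. (norm (e p))\<^sup>2) \<le> (?y - ?x)\<^sup>2 * integral {?x..?y} (\<lambda>p. (norm (e' p))\<^sup>2)"
    proof (rule poincare_zero_left)
      show "e ?x = 0" using S_grid[of "M + j"] Suc.prems x0 by (simp add: e_def)
    qed (use dp_pos xy e_deriv cont_e' in auto)
    moreover have "integral {0..?y} f = integral {0..?x} f + integral {?x..?y} f"
      if "f integrable_on {0..?y}" for f :: "real \<Rightarrow> real"
      using Henstock_Kurzweil_Integration.integral_combine[of 0 ?x ?y f] that x0 dp_pos xy by simp
    ultimately show ?case using Suc i xy by (simp add: distrib_left)
  qed
  from this[of M] have "integral {0..pi * L} (\<lambda>p. (norm (e p))\<^sup>2) \<le>
      (dp L N)\<^sup>2 * integral {0..pi * L} (\<lambda>p. (norm (e' p))\<^sup>2)"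
    using M gridN by (simp add: mult_2)
  \<comment> \<open>26 = 2 * 12 + 2 * 1, from the derivative of the interpolant and that of
    exp(-p).\<close>
  moreover have "integral {0..pi * L} (\<lambda>p. (norm (e' p))\<^sup>2) \<le> 26"
  proof -
    have "integral {0..pi * L} (\<lambda>p. (norm (e' p))\<^sup>2) \<le> 2 * integral {0..pi * L} (\<lambda>p. (norm (S' p))\<^sup>2)
       + 2 * integral {0..pi * L} (\<lambda>p. (norm (complex_of_real (- exp (- p))))\<^sup>2)"
      unfolding e'_def by (intro integral_diff_sq_le continuous_S' continuous_intros)
    then show ?thesis
      using integral_S'_le integral_exp_sq_le[of "pi * L"] L by simp
  qed
  ultimately have "integral {0..pi * L} (\<lambda>p. (norm (e p))\<^sup>2) \<le> (dp L N)\<^sup>2 * 26"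
    by (meson mult_left_mono order_trans zero_le_power2)
  then show ?thesis by (simp add: e_def mult.commute)
qed

text \<open>Beyond \<open>pi * L\<close> the interpolant continues periodically and no longer
  approximates exp(-p); only the sizes of the two functions are used.\<close>

lemma coarse_error_le:
  assumes M: "pi * L < M"
  shows "integral {0..M} (\<lambda>p. (norm (S p - of_real (exp (- p))))\<^sup>2) \<le> 6 * M + 2"
proof -
  have "0 < M" using M L by (meson mult_pos_pos order_less_trans pi_gt_zero)
  have "integral {0..M} (\<lambda>p. (norm (S p - of_real (exp (- p))))\<^sup>2) \<le> 2 * integral {0..M} (\<lambda>p. (norm (S p))\<^sup>2)
       + 2 * integral {0..M} (\<lambda>p. (norm (complex_of_real (exp (- p))))\<^sup>2)"
    by (intro integral_diff_sq_le continuous_S continuous_intros)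
  then show ?thesis
    using integral_S_le[OF M] integral_exp_sq_le[of M] \<open>0 < M\<close> by simp
qed

end

section \<open>The error of the semidiscrete scheme\<close>

lemma bounded_bilinear_matrix_vector:
  "bounded_bilinear ((*v) :: complex^'n^'m \<Rightarrow> complex^'n \<Rightarrow> complex^'m)"
  unfolding bilinear_conv_bounded_bilinear[symmetric] bilinear_def
  by (auto intro!: linearI simp: vec_eq_iff matrix_vector_mult_def algebra_simps sum.distrib scaleR_sum_right)

lemmas continuous_on_matrix_vector_mult = bounded_bilinear.continuous_on[OF bounded_bilinear_matrix_vector]

lemma bounded_bilinear_scalar_mult_complex:
  "bounded_bilinear ((*s) :: complex \<Rightarrow> complex^'n \<Rightarrow> complex^'n)"
  by (rule bounded_bilinear.intro)
    (auto simp: vec_eq_iff algebra_simps norm_scalar_mult_complex intro!: exI[of _ 1])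

lemmas continuous_on_scalar_mult_complex = bounded_bilinear.continuous_on[OF bounded_bilinear_scalar_mult_complex]

lemma continuous_on_adj:
  assumes "continuous_on X M"
  shows "continuous_on X (\<lambda>t. adj (M t))"
  unfolding adj_def map_matrix_def transpose_def
  by (intro continuous_intros continuous_on_vec_lambda) (simp add: assms continuous_on_component)

lemma continuous_on_herm1: "continuous_on X M \<Longrightarrow> continuous_on X (\<lambda>t. herm1 (M t))"
  unfolding herm1_def by (intro continuous_intros continuous_on_adj)

lemma continuous_on_herm2:
  assumes "continuous_on X M"
  shows "continuous_on X (\<lambda>t. herm2 (M t))"
proof -
  have "continuous_on X (\<lambda>t. M t - adj (M t))"
    by (intro continuous_intros continuous_on_adj assms)
  then show ?thesis unfolding herm2_def map_matrix_def
    by (intro continuous_intros continuous_on_vec_lambda continuous_on_component continuous_on_adj assms) auto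
qed

text \<open>Sums of separated modes cover both the Fourier modes, with \<kappa> = i \<mu>_l, and the
  exact solution, with \<kappa> = -1, so their difference is handled at once. The speed of the right
  end is the operator bound \<open>Lam\<close>, the left one is the sharp
  \<open>lam_max_pos\<close>.\<close>

lemma mode_sum_energy:
  fixes M :: "real \<Rightarrow> complex^'m^'m" and z :: "nat \<Rightarrow> real \<Rightarrow> complex^'m"
    and \<phi> :: "nat \<Rightarrow> real \<Rightarrow> complex" and \<kappa> :: "nat \<Rightarrow> complex"
  assumes T: "0 < T" and fin: "finite J" and M: "continuous_on {0..T} M"
    and bound: "\<And>t x. t \<in> {0..T} \<Longrightarrow> norm (M t *v x) \<le> Lam * norm x"
    and \<phi>: "\<And>j p. j \<in> J \<Longrightarrow> (\<phi> j has_vector_derivative \<kappa> j * \<phi> j p) (at p)"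
    and z: "\<And>j t. j \<in> J \<Longrightarrow> t \<in> {0..T} \<Longrightarrow> (z j has_vector_derivative
        (\<i> *s (herm2 (M t) *v z j t) - \<kappa> j *s (herm1 (M t) *v z j t))) (at t within {0..T})"
    and lam: "lam = lam_max_pos T (\<lambda>t. herm1 (M t))"
    and ab: "a + lam * T \<le> b - Lam * T" "a \<le> b"
  shows "integral {a + lam * T..b - Lam * T} (\<lambda>p. (norm (\<Sum>j\<in>J. \<phi> j p *s z j T))\<^sup>2)
    \<le> integral {a..b} (\<lambda>p. (norm (\<Sum>j\<in>J. \<phi> j p *s z j 0))\<^sup>2)"
proof (rule energy_trapezoid[OF T, where H = "\<lambda>t x. herm1 (M t) *v x" and S = "\<lambda>t x. \<i> *s (herm2 (M t) *v x)"
    and E = "\<lambda>t p. \<Sum>j\<in>J. \<phi> j p *s z j t"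
    and Ep = "\<lambda>t p. \<Sum>j\<in>J. (\<kappa> j * \<phi> j p) *s z j t"
    and Et = "\<lambda>t p. \<Sum>j\<in>J. \<phi> j p *s (\<i> *s (herm2 (M t) *v z j t) - \<kappa> j *s (herm1 (M t) *v z j t))"])
  fix t p assume t: "t \<in> {0..T}"
  show "((\<lambda>x. \<Sum>j\<in>J. \<phi> j (snd x) *s z j (fst x)) has_derivative
      (\<lambda>h. fst h *\<^sub>R (\<Sum>j\<in>J. \<phi> j p *s (\<i> *s (herm2 (M t) *v z j t) - \<kappa> j *s (herm1 (M t) *v z j t))) +
        snd h *\<^sub>R (\<Sum>j\<in>J. (\<kappa> j * \<phi> j p) *s z j t))) (at (t, p) within {0..T} \<times> UNIV)"
  proof -
    have "((\<lambda>x. \<Sum>j\<in>J. \<phi> j (snd x) *s z j (fst x)) has_derivative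
      (\<lambda>h. \<Sum>j\<in>J. \<phi> j (snd (t, p)) *s (fst h *\<^sub>R (\<i> *s (herm2 (M t) *v z j t) - \<kappa> j *s (herm1 (M t) *v z j t))) +
        (snd h *\<^sub>R (\<kappa> j * \<phi> j p)) *s z j (fst (t, p)))) (at (t, p) within {0..T} \<times> UNIV)"
    proof (intro has_derivative_sum bounded_bilinear.FDERIV[OF bounded_bilinear_scalar_mult_complex])
      fix j assume j: "j \<in> J"
      show "((\<lambda>x. \<phi> j (snd x)) has_derivative (\<lambda>h. snd h *\<^sub>R (\<kappa> j * \<phi> j p))) (at (t, p) within {0..T} \<times> UNIV)"
        by (rule has_derivative_compose[where f = snd, OF has_derivative_snd[OF has_derivative_ident]])
          (use \<phi>[OF j, of p] in \<open>simp add: has_vector_derivative_def\<close>)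
      have img: "fst ` ({0..T} \<times> (UNIV::real set)) = {0..T}" by force
      show "((\<lambda>x. z j (fst x)) has_derivative
          (\<lambda>h. fst h *\<^sub>R (\<i> *s (herm2 (M t) *v z j t) - \<kappa> j *s (herm1 (M t) *v z j t)))) (at (t, p) within {0..T} \<times> UNIV)"
        by (rule has_derivative_in_compose[where f = fst, OF has_derivative_fst[OF has_derivative_ident]])
          (use z[OF j t] in \<open>simp add: has_vector_derivative_def img\<close>)
    qed
    moreover have "r *\<^sub>R (c *s x) = c *s (r *\<^sub>R x)" "(r *\<^sub>R c) *s x = r *\<^sub>R (c *s x)" for r c and x :: "complex^'m"
      by (auto simp: vec_eq_iff)
    ultimately show ?thesis
      by (simp only: sum.distrib scaleR_sum_right fst_conv snd_conv)
  qed
  show "(\<Sum>j\<in>J. \<phi> j p *s (\<i> *s (herm2 (M t) *v z j t) - \<kappa> j *s (herm1 (M t) *v z j t))) =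
      \<i> *s (herm2 (M t) *v (\<Sum>j\<in>J. \<phi> j p *s z j t)) - herm1 (M t) *v (\<Sum>j\<in>J. (\<kappa> j * \<phi> j p) *s z j t)"
  proof -
    have lin: "N *v (\<Sum>j\<in>J. c j *s x j) = (\<Sum>j\<in>J. c j *s (N *v x j))"
      for N :: "complex^'m^'m" and c :: "nat \<Rightarrow> complex" and x
      by (simp add: linear_sum[OF bounded_linear.linear[OF bounded_linear_matrix_vector]] vector_scalar_commute)
    have s: "c *s (\<Sum>j\<in>J. x j) = (\<Sum>j\<in>J. c *s x j)" for c :: complex and x :: "nat \<Rightarrow> complex^'m"
      by (simp add: vec_eq_iff sum_distrib_left)
    show ?thesis
      unfolding lin s sum_subtractf[symmetric]
      by (intro sum.cong refl) (simp add: vec_eq_iff algebra_simps)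
  qed
next
  have cfst: "continuous_on ({0..T} \<times> (UNIV::real set)) (\<lambda>x. g (fst x))" if "continuous_on {0..T} g"
    for g :: "real \<Rightarrow> complex^'m"
    by (rule continuous_on_compose2[OF that]) (auto intro!: continuous_intros)
  have c\<phi>: "continuous_on X (\<lambda>x. \<phi> j (snd x))" if "j \<in> J" for j and X :: "(real \<times> real) set"
  proof -
    have "continuous_on UNIV (\<phi> j)"
      unfolding continuous_on_eq_continuous_within
      using has_vector_derivative_continuous[OF \<phi>[OF that]] by simp
    then show ?thesis
      by (rule continuous_on_compose2) (auto intro!: continuous_intros)
  qed
  have cz: "continuous_on {0..T} (z j)" if "j \<in> J" for j
    unfolding continuous_on_eq_continuous_within
    using has_vector_derivative_continuous[OF z[OF that]] by blast
  show "continuous_on ({0..T} \<times> UNIV) (\<lambda>x. \<Sum>j\<in>J. \<phi> j (snd x) *s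
      (\<i> *s (herm2 (M (fst x)) *v z j (fst x)) - \<kappa> j *s (herm1 (M (fst x)) *v z j (fst x))))"
    by (intro continuous_on_sum continuous_on_scalar_mult_complex c\<phi> cfst continuous_on_diff
        continuous_on_const continuous_on_matrix_vector_mult continuous_on_herm1 continuous_on_herm2 M cz)
  show "continuous_on ({0..T} \<times> UNIV) (\<lambda>x. \<Sum>j\<in>J. (\<kappa> j * \<phi> j (snd x)) *s z j (fst x))"
    by (intro continuous_on_sum continuous_on_scalar_mult_complex c\<phi> cfst continuous_on_mult
        continuous_on_const cz)
next
  fix t x assume t: "0 < t" "t < T"
  show "inner x (herm1 (M t) *v x) \<le> lam * (norm x)\<^sup>2"
    unfolding lam by (rule lam_max_pos_upper(1)[OF bound t]) auto
  have "\<bar>inner x (M t *v x)\<bar> \<le> norm x * norm (M t *v x)" by (rule Cauchy_Schwarz_ineq2)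
  also have "\<dots> \<le> norm x * (Lam * norm x)" using t by (intro mult_left_mono bound) auto
  finally show "- (Lam * (norm x)\<^sup>2) \<le> inner x (herm1 (M t) *v x)"
    by (simp add: inner_herm1_self power2_eq_square mult_ac)
qed (simp_all add: ab inner_herm1 inner_i_herm2_self bounded_linear_matrix_vector)

text \<open>exp(2 Lam t) |y(t)|^2 is nondecreasing, because the derivative of |y|^2 is at least -2
  Lam |y|^2.\<close>

lemma backward_growth_bound:
  fixes M :: "real \<Rightarrow> complex^'m^'m"
  assumes T: "0 < T" and y: "\<And>t. t \<in> {0..T} \<Longrightarrow> (y has_vector_derivative M t *v y t) (at t within {0..T})"
    and bound: "\<And>t x. t \<in> {0..T} \<Longrightarrow> norm (M t *v x) \<le> Lam * norm x"
  shows "norm (y 0) \<le> exp (Lam * T) * norm (y T)"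
proof -
  define f where "f t = exp (2 * Lam * t) * inner (y t) (y t)" for t
  have f: "(f has_real_derivative exp (2 * Lam * t) * (2 * Lam * inner (y t) (y t) + 2 * inner (y t) (M t *v y t)))
     (at t within {0..T})" if "t \<in> {0..T}" for t
    unfolding f_def has_field_derivative_def
    by (rule derivative_eq_intros y[OF that, unfolded has_vector_derivative_def] refl)+
      (auto simp: fun_eq_iff algebra_simps inner_commute)
  have "f 0 \<le> f T"
  proof (rule DERIV_nonneg_imp_increasing_open[of 0 T f])
    fix t assume t: "0 < t" "t < T"
    have "\<bar>inner (y t) (M t *v y t)\<bar> \<le> norm (y t) * norm (M t *v y t)" by (rule Cauchy_Schwarz_ineq2)
    also have "\<dots> \<le> norm (y t) * (Lam * norm (y t))" using t by (intro mult_left_mono bound) auto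
    also have "\<dots> = Lam * inner (y t) (y t)" by (simp add: dot_square_norm power2_eq_square)
    finally have "0 \<le> 2 * Lam * inner (y t) (y t) + 2 * inner (y t) (M t *v y t)" by linarith
    moreover have "(f has_real_derivative exp (2 * Lam * t) * (2 * Lam * inner (y t) (y t) + 2 * inner (y t) (M t *v y t))) (at t)"
      using f[of t] t by (simp add: at_within_Icc_at)
    ultimately show "\<exists>d. (f has_real_derivative d) (at t) \<and> 0 \<le> d"
      by (meson exp_ge_zero mult_nonneg_nonneg)
  next
    show "continuous_on {0..T} f" by (rule DERIV_continuous_on) (use f in auto)
  qed (use T in auto)
  then have "(norm (y 0))\<^sup>2 \<le> (exp (Lam * T) * norm (y T))\<^sup>2"
    by (simp add: f_def dot_square_norm power_mult_distrib mult_ac flip: exp_double)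
  then show ?thesis by (rule power2_le_imp_le) simp
qed

section \<open>The L2 norm and the bound on the source term\<close>

lemma set_lebesgue_integral_open_interval:
  fixes f :: "real \<Rightarrow> real"
  assumes "continuous_on {a..b} f"
  shows "set_lebesgue_integral lborel {a<..<b} f = integral {a..b} f"
proof -
  have "set_integrable lborel {a<..<b} f"
    by (rule set_integrable_subset[OF borel_integrable_atLeastAtMost'[OF assms]]) auto
  then show ?thesis
    by (simp add: set_borel_integral_eq_integral integral_open_interval_real)
qed

lemma linf_norm_ge: "cmod (v $ i) \<le> linf_norm v"
  unfolding linf_norm_def by (rule Max_ge) auto

lemma linf_norm_le_norm: "linf_norm v \<le> norm v"
  unfolding linf_norm_def by (auto intro: Max.boundedI simp: norm_nth_le Finite_Cartesian_Product.norm_nth_le)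

lemma norm_le_b_max:
  fixes b :: "real \<Rightarrow> complex^'n"
  assumes b: "continuous_on {0..T} b" and t: "t \<in> {0..T}"
  shows "cmod (b t $ i) \<le> b_max T b"
proof -
  have "bounded (b ` {0..T})"
    by (intro compact_imp_bounded compact_continuous_image b compact_Icc)
  then obtain B where "\<forall>x\<in>b ` {0..T}. norm x \<le> B" unfolding bounded_iff by blast
  then have B: "\<And>t. t \<in> {0..T} \<Longrightarrow> norm (b t) \<le> B" by blast
  have "bdd_above ((\<lambda>t. linf_norm (b t)) ` {0..T})"
    using B linf_norm_le_norm order_trans by (intro bdd_aboveI[of _ B]) fastforce
  then have "linf_norm (b t) \<le> b_max T b" unfolding b_max_def by (rule cSUP_upper[OF t])
  then show ?thesis using linf_norm_ge[of "b t" i] by linarith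
qed

lemma b_max_pos:
  assumes "continuous_on {0..T} b" "t \<in> {0..T}" "b t \<noteq> 0"
  shows "0 < b_max T b"
proof -
  obtain i where "b t $ i \<noteq> 0" using assms(3) by (auto simp: vec_eq_iff)
  then show ?thesis using norm_le_b_max[OF assms(1,2), of i] by (smt (verit) zero_less_norm_iff)
qed

text \<open>Both \<open>Dp\<close> and \<open>id_N\<close> are diagonal, so the semidiscrete system
  decouples into one ordinary differential equation for each Fourier mode.\<close>

lemma tensor_mv_Dp: "j < N \<Longrightarrow> tensor_mv N (Dp L N) H w j = of_real (mu L N j) *s (H *v w j)"
  by (simp add: tensor_mv_def Dp_def if_distribR if_distrib cong: if_cong)

lemma tensor_mv_id_N: "j < N \<Longrightarrow> tensor_mv N id_N H w j = H *v w j"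
  by (simp add: tensor_mv_def id_N_def if_distribR if_distrib cong: if_cong)

lemma tensor_mv_mat_1: "tensor_mv N M (mat 1) (tensor_vec x v) j = (\<Sum>l<N. M j l * x l) *s v"
  by (simp add: tensor_mv_def tensor_vec_def vec_eq_iff sum_distrib_right sum_distrib_left mult_ac)

text \<open>The initial Fourier coefficients are thus those of the trigonometric interpolant of the
  samples \<open>x\<close>.\<close>

lemma inv_N_Phi_interpolates:
  assumes "N > 0" "L > 0" "k < N"
  shows "(\<Sum>l<N. (\<Sum>k'<N. inv_N N (Phi L N) l k' * x k') * Phi L N k l) = x k"
proof -
  have "(\<Sum>l<N. (\<Sum>k'<N. inv_N N (Phi L N) l k' * x k') * Phi L N k l) =
      (\<Sum>k'<N. (\<Sum>l<N. Phi L N k l * inv_N N (Phi L N) l k') * x k')"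
    unfolding sum_distrib_right by (subst sum.swap) (simp add: mult_ac)
  also have "\<dots> = (\<Sum>k'<N. id_N k k' * x k')"
    using inv_N_Phi[OF assms] by (intro sum.cong) auto
  also have "\<dots> = x k" using assms by (simp add: id_N_def if_distribR if_distrib cong: if_cong)
  finally show ?thesis .
qed

lemma block_fst_linear:
  fixes x y :: "complex^('n::finite + 'n)"
  shows "block_fst (x - y) = block_fst x - block_fst y" "block_fst (c *s x) = c *s block_fst x"
    "block_fst (\<Sum>j\<in>J. f j) = (\<Sum>j\<in>J. block_fst (f j :: complex^('n + 'n)))"
  by (simp_all add: block_fst_def vec_eq_iff)

text \<open>With \<open>g * r = 1\<close> the coupling block turns the constant
  \<open>r *s r0\<close> into exactly the source \<open>b\<close>, while the zero rows keep the
  second component constant.\<close>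

lemma augmented_ode:
  fixes A :: "complex^'n^'n"
  assumes u: "(u has_vector_derivative (A *v u t + b)) (at t within X)" and gr: "of_real g * r = 1"
  shows "((\<lambda>t. block_vec (u t) (r *s r0)) has_vector_derivative
     aug_mat g A b *v block_vec (u t) (r *s r0)) (at t within X)"
proof -
  have eq: "aug_mat g A b *v block_vec (u t) (r *s r0) = block_vec (A *v u t + b) 0"
  proof -
    have "of_real g * x * r = x" for x using gr by (metis mult.assoc mult.commute mult_1_right)
    then have "(\<chi> i. of_real g * b $ i * (r *s r0) $ i) = b" by (simp only: vec_eq_iff) (simp add: r0_def)
    then show ?thesis by (simp only: aug_mat_mult)
  qed
  have "linear (\<lambda>x :: complex^'n. block_vec x 0)"
    by (auto intro!: linearI simp: vec_eq_iff block_vec_def split: sum.splits)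
  then have "bounded_linear (\<lambda>x :: complex^'n. block_vec x 0)" by (simp add: linear_conv_bounded_linear)
  from bounded_linear.has_vector_derivative[OF this u]
  have "((\<lambda>t. block_vec (u t) 0 + block_vec 0 (r *s r0)) has_vector_derivative block_vec (A *v u t + b) 0 + 0) (at t within X)"
    by (intro has_vector_derivative_add has_vector_derivative_const)
  moreover have "block_vec x 0 + block_vec 0 y = block_vec x y" for x y :: "complex^'n"
    by (auto simp: vec_eq_iff block_vec_def split: sum.splits)
  ultimately show ?thesis by (simp add: eq)
qed

lemma continuous_on_if_const:
  "(P \<Longrightarrow> continuous_on X f) \<Longrightarrow> (\<not> P \<Longrightarrow> continuous_on X g) \<Longrightarrow> continuous_on X (\<lambda>x. if P then f x else g x)"
  by (cases P) simp_all

lemma continuous_on_aug_mat: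
  fixes A :: "real \<Rightarrow> complex^'n^'n"
  assumes "continuous_on X A" "continuous_on X b"
  shows "continuous_on X (\<lambda>t. aug_mat g (A t) (b t))"
proof -
  have "continuous_on X (\<lambda>t. aug_mat g (A t) (b t) $ r $ c)" for r c
    unfolding aug_mat_def block_mat_def map_matrix_def diag_mat_def
    by (cases r; cases c) (auto intro!: continuous_intros assms continuous_on_if_const)
  then show ?thesis
    using continuous_on_vec_lambda[of X "\<lambda>r t. (\<chi> c. aug_mat g (A t) (b t) $ r $ c)"] continuous_on_vec_lambda[of X "\<lambda>c t. aug_mat g (A t) (b t) $ r $ c" for r]
    by (simp add: vec_lambda_eta)
qed

text \<open>The energy estimate carries the error at time \<open>T\<close> back to an interpolation
  error on a part of \<open>{0..M}\<close>. The two conclusions differ in whether this range fits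
  into the half-period \<open>pi * L\<close>.\<close>

lemma recovered_error_le:
  fixes T :: real and A :: "real \<Rightarrow> complex^'n^'n" and b :: "real \<Rightarrow> complex^'n"
  assumes T: "T > 0" and A: "continuous_on {0..T} A" and b: "continuous_on {0..T} b"
    and g: "of_real g * r = (1 :: complex)"
    and bound: "\<And>t x. t \<in> {0..T} \<Longrightarrow> norm (aug_mat g (A t) (b t) *v x) \<le> Lam * norm x"
    and u: "\<And>t. t \<in> {0..T} \<Longrightarrow> (u has_vector_derivative (A t *v u t + b t)) (at t within {0..T})"
    and w: "\<And>t j. t \<in> {0..T} \<Longrightarrow> j < N \<Longrightarrow> ((\<lambda>s. w s j) has_vector_derivative
          (- \<i>) *s (of_real (mu L N j) *s (H1g g (A t) (b t) *v w t j) - H2g g (A t) (b t) *v w t j)) (at t within {0..T})"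
    and w0: "\<And>j. j < N \<Longrightarrow> w 0 j = c j *s block_vec (u 0) (r *s r0)"
    and L: "L > 0" and N: "N > 0" "even N"
    and c: "\<And>k. k < N \<Longrightarrow> (\<Sum>l<N. c l * Phi L N k l) = psi_h L N k"
    and p: "lam_max_pos T (\<lambda>t. H1g g (A t) (b t)) * T \<le> p"
    and R: "R \<ge> 0" and Q: "p + R \<le> Q" and M: "Q + Lam * T \<le> M" and Lam: "Lam \<ge> 0"
  shows "pi * L \<ge> M \<Longrightarrow> L2_norm_on {p<..<p + R} (\<lambda>p. u_approx L N (w T) p - u T) \<le>
      exp Q * (6 * dp L N * norm (block_vec (u 0) (r *s r0)))" (is "_ \<Longrightarrow> ?concl1")
    and "pi * L < M \<Longrightarrow> L2_norm_on {p<..<p + R} (\<lambda>p. u_approx L N (w T) p - u T) \<le>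
      exp Q * ((6 * M + 2) * norm (block_vec (u 0) (r *s r0)))" (is "_ \<Longrightarrow> ?concl2")
proof -
  interpret trig_interpolant L N c by unfold_locales (use L N c in auto)
  define y where "y t = block_vec (u t) (r *s r0)" for t
  define lam where "lam = lam_max_pos T (\<lambda>t. H1g g (A t) (b t))"
  \<comment> \<open>The indices below \<open>N\<close> carry the numerical modes; the index
    \<open>N\<close> carries the exact solution, with a minus sign in \<open>\<phi>\<close>. The sum
    over all of them is the error.\<close>
  define z where "z j t = (if j < N then w t j else y t)" for j t
  define \<phi> where "\<phi> j q = (if j < N then wave L N j q else - of_real (exp (- q)))" for j q
  define \<kappa> where "\<kappa> j = (if j < N then \<i> * of_real (mu L N j) else - 1)" for j
  define E where "E t q = (\<Sum>j\<le>N. \<phi> j q *s z j t)" for t q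
  \<comment> \<open>The foot of the trapezoid at time 0. The recovery threshold is exactly what
    makes \<open>a0\<close> nonnegative, away from the kink's left side, where exp(-p) is not the
    initial datum.\<close>
  define a0 where "a0 = p - lam * T"
  define b0 where "b0 = p + R + Lam * T"
  have E_eq: "E t q = (\<Sum>j<N. wave L N j q *s w t j) - of_real (exp (- q)) *s y t" for t q
    unfolding E_def lessThan_Suc_atMost[symmetric] by (simp add: \<phi>_def z_def vec_eq_iff)
  have lam: "lam = lam_max_pos T (\<lambda>t. herm1 (aug_mat g (A t) (b t)))"
    by (simp add: lam_def H1g_eq_herm1)
  have lam0: "0 \<le> lam"
    unfolding lam
    by (rule lam_max_pos_upper(2)[where M = "\<lambda>t. aug_mat g (A t) (b t)" and t = "T/2" and \<Lambda> = Lam])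
      (use T bound in auto)
  have a0: "0 \<le> a0" using p by (simp add: a0_def lam_def)
  have b0: "b0 \<le> M" using Q M by (simp add: b0_def)
  have lT: "0 \<le> lam * T" "0 \<le> Lam * T" using lam0 Lam T by auto
  have ab: "a0 \<le> b0" using lT R by (simp add: a0_def b0_def)
  have \<phi>': "(\<phi> j has_vector_derivative \<kappa> j * \<phi> j q) (at q)" for j q
  proof (cases "j < N")
    case True
    then show ?thesis using has_vector_derivative_wave[of L N j q UNIV] by (simp add: \<phi>_def[abs_def] \<kappa>_def)
  next
    case False
    have "((\<lambda>p. - complex_of_real (exp (- p))) has_vector_derivative - complex_of_real (- exp (- q))) (at q)"
      by (intro has_vector_derivative_minus has_vector_derivative_of_real) (auto intro!: derivative_eq_intros)
    then show ?thesis using False by (simp add: \<phi>_def[abs_def] \<kappa>_def)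
  qed
  have y': "(y has_vector_derivative aug_mat g (A t) (b t) *v y t) (at t within {0..T})" if "t \<in> {0..T}" for t
    unfolding y_def[abs_def] by (rule augmented_ode[OF u[OF that] g])
  have z': "(z j has_vector_derivative (\<i> *s (herm2 (aug_mat g (A t) (b t)) *v z j t)
      - \<kappa> j *s (herm1 (aug_mat g (A t) (b t)) *v z j t))) (at t within {0..T})" if t: "t \<in> {0..T}" for j t
  proof (cases "j < N")
    case True
    have "(- \<i>) *s (of_real (mu L N j) *s x - x') = \<i> *s x' - (\<i> * of_real (mu L N j)) *s x"
      for x x' :: "complex^('n + 'n)" by (simp add: vec_eq_iff algebra_simps)
    then show ?thesis using True w[OF t True] by (simp add: z_def[abs_def] \<kappa>_def H1g_eq_herm1 H2g_eq_herm2)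
  next
    case False
    have "\<i> *s (herm2 X *v x) - (- 1) *s (herm1 X *v x) = herm1 X *v x + \<i> *s (herm2 X *v x)"
      for X and x :: "complex^('n + 'n)" by (simp add: vec_eq_iff)
    then have "\<i> *s (herm2 X *v x) - (- 1) *s (herm1 X *v x) = X *v x" for X and x :: "complex^('n + 'n)"
      by (simp only: herm1_plus_i_herm2)
    then show ?thesis using False y'[OF t] by (simp only: z_def[abs_def] \<kappa>_def if_False)
  qed
  have energy: "integral {p..p + R} (\<lambda>q. (norm (E T q))\<^sup>2) \<le> integral {a0..b0} (\<lambda>q. (norm (E 0 q))\<^sup>2)"
    using mode_sum_energy[where J = "{..N}" and z = z and \<phi> = \<phi> and \<kappa> = \<kappa>, OF T _ continuous_on_aug_mat[OF A b] bound \<phi>' z' lam, of a0 b0] ab R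
    by (simp add: E_def a0_def b0_def)
  have E0: "E 0 q = (S q - of_real (exp (- q))) *s y 0" for q
  proof -
    have "(\<Sum>j<N. wave L N j q *s w 0 j) = S q *s y 0"
      by (simp add: w0 S_def y_def[symmetric] vec_eq_iff sum_distrib_left sum_distrib_right mult_ac)
    then show ?thesis by (simp add: E_eq vec_eq_iff algebra_simps)
  qed
  define I where "I X = integral {0..X} (\<lambda>q. (norm (S q - of_real (exp (- q))))\<^sup>2)" for X
  have initial: "integral {a0..b0} (\<lambda>q. (norm (E 0 q))\<^sup>2) \<le> (norm (y 0))\<^sup>2 * I X" if X: "b0 \<le> X" for X
  proof -
    have "integral {a0..b0} (\<lambda>q. (norm (E 0 q))\<^sup>2) =
        (norm (y 0))\<^sup>2 * integral {a0..b0} (\<lambda>q. (norm (S q - of_real (exp (- q))))\<^sup>2)"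
      unfolding E0 norm_scalar_mult_complex power_mult_distrib by (simp add: mult.commute)
    also have "\<dots> \<le> (norm (y 0))\<^sup>2 * I X"
      unfolding I_def using a0 X
      by (intro mult_left_mono integral_subset_le integrable_continuous_real continuous_intros continuous_S) auto
    finally show ?thesis .
  qed
  have cont_E: "continuous_on {p..p + R} (E T)"
    unfolding E_eq[abs_def] by (intro continuous_intros continuous_on_scalar_mult_complex)
  \<comment> \<open>Multiplication by \<open>exp q\<close> undoes the factor exp(-q) of the exact
    solution; on the recovery interval it costs at most \<open>exp Q\<close>.\<close>
  have fst: "u_approx L N (w T) q - u T = exp q *\<^sub>R block_fst (E T q)" for q
  proof -
    have "block_fst (E T q) = (\<Sum>l<N. wave L N l q *s block_fst (w T l)) - of_real (exp (- q)) *s u T"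
      unfolding E_eq by (simp add: block_fst_linear y_def)
    moreover have "exp q *\<^sub>R (of_real (exp (- q)) *s x) = x" for x :: "complex^'n"
      by (simp add: vec_eq_iff scaleR_conv_of_real[where 'a = complex] flip: exp_of_real exp_add)
    ultimately show ?thesis by (simp add: u_approx_def wave_def scaleR_diff_right)
  qed
  have cont_u: "continuous_on {p..p + R} (\<lambda>q. u_approx L N (w T) q - u T)"
    unfolding u_approx_def by (intro continuous_intros continuous_on_scalar_mult_complex)
  have main: "L2_norm_on {p<..<p + R} (\<lambda>p. u_approx L N (w T) p - u T) \<le> exp Q * (s * norm (y 0))"
    if X: "b0 \<le> X" and I: "I X \<le> s\<^sup>2" and s: "s \<ge> 0" for X s
  proof -
    have "integral {p..p + R} (\<lambda>q. (norm (u_approx L N (w T) q - u T))\<^sup>2) \<le>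
        integral {p..p + R} (\<lambda>q. (exp Q)\<^sup>2 * (norm (E T q))\<^sup>2)"
    proof (intro integral_le integrable_continuous_real continuous_on_power continuous_on_norm
          continuous_on_mult continuous_on_const cont_u cont_E)
      fix q assume q: "q \<in> {p..p + R}"
      have "norm (u_approx L N (w T) q - u T) \<le> exp Q * norm (E T q)"
        unfolding fst norm_scaleR using q Q by (intro mult_mono norm_block_fst_le) auto
      then show "(norm (u_approx L N (w T) q - u T))\<^sup>2 \<le> (exp Q)\<^sup>2 * (norm (E T q))\<^sup>2"
        unfolding power_mult_distrib[symmetric] by (intro power_mono) auto
    qed
    also have "\<dots> = (exp Q)\<^sup>2 * integral {p..p + R} (\<lambda>q. (norm (E T q))\<^sup>2)" by simp
    also have "\<dots> \<le> (exp Q)\<^sup>2 * ((norm (y 0))\<^sup>2 * s\<^sup>2)"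
    proof (intro mult_left_mono)
      have "integral {p..p + R} (\<lambda>q. (norm (E T q))\<^sup>2) \<le> (norm (y 0))\<^sup>2 * I X"
        using energy initial[OF X] by linarith
      also have "\<dots> \<le> (norm (y 0))\<^sup>2 * s\<^sup>2" by (intro mult_left_mono I) auto
      finally show "integral {p..p + R} (\<lambda>q. (norm (E T q))\<^sup>2) \<le> (norm (y 0))\<^sup>2 * s\<^sup>2" .
    qed auto
    also have "\<dots> = (exp Q * (s * norm (y 0)))\<^sup>2" by (simp add: power_mult_distrib mult_ac)
    finally have "integral {p..p + R} (\<lambda>q. (norm (u_approx L N (w T) q - u T))\<^sup>2) \<le> (exp Q * (s * norm (y 0)))\<^sup>2" .
    then show ?thesis
      unfolding L2_norm_on_def
        set_lebesgue_integral_open_interval[OF continuous_on_power[OF continuous_on_norm[OF cont_u]]]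
      using s by (intro real_le_lsqrt) auto
  qed
  show ?concl1 if "pi * L \<ge> M"
    unfolding y_def[symmetric]
  proof (rule main[of "pi * L"])
    show "I (pi * L) \<le> (6 * dp L N)\<^sup>2"
    proof -
      have "26 * (dp L N)\<^sup>2 \<le> (6 * dp L N)\<^sup>2" by (simp add: power_mult_distrib)
      then show ?thesis using interpolation_error_le unfolding I_def by linarith
    qed
  qed (use that b0 dp_pos in auto)
  show ?concl2 if "pi * L < M"
    unfolding y_def[symmetric]
  proof (rule main[of M])
    have "0 < M" using that L by (meson mult_pos_pos order_less_trans pi_gt_zero)
    \<comment> \<open>The integral bounds the square of the error norm; as \<open>6 * M + 2\<close>
      is at least 1, it may be replaced by its own square.\<close>
    then have "6 * M + 2 \<le> (6 * M + 2)\<^sup>2" by (intro self_le_power) auto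
    then show "I M \<le> (6 * M + 2)\<^sup>2"
      using coarse_error_le[OF that] by (simp add: I_def)
    show "0 \<le> 6 * M + 2" using \<open>0 < M\<close> by simp
  qed (use b0 in auto)
qed

text \<open>\<open>K\<close> is a common bound for the implied constants: for
  \<open>C\<^sub>T\<close>, for \<open>exp R\<close>, and for the offset of \<open>p\<gamma>\<close>
  relative to \<gamma> |b| T. The constant \<open>C\<close> is chosen from \<open>T\<close>,
  \<open>A\<close> and \<open>K\<close> alone.\<close>

theorem corollary5p4:
  fixes T K :: real and A :: "real \<Rightarrow> complex^'n^'n"
  assumes "T > 0" and "continuous_on {0..T} A"
  shows "\<exists>C>0. \<forall>(b :: real \<Rightarrow> complex^'n) (u0 :: complex^'n) (u :: real \<Rightarrow> complex^'n)
      (C\<^sub>T :: real) (\<epsilon> :: real) (R :: real) (L :: real) (N :: nat) (p\<gamma> :: real)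
      (w :: real \<Rightarrow> nat \<Rightarrow> complex^('n + 'n)).
    continuous_on {0..T} b \<longrightarrow>
    (\<exists>t\<in>{0..T}. b t \<noteq> 0) \<longrightarrow>
    u 0 = u0 \<longrightarrow>
    (\<forall>t\<in>{0..T}. (u has_vector_derivative (A t *v u t + b t)) (at t within {0..T})) \<longrightarrow>
    T \<le> C\<^sub>T \<longrightarrow> C\<^sub>T \<le> K \<longrightarrow>
    \<epsilon> > 0 \<longrightarrow>
    R \<ge> 1 \<longrightarrow> exp R \<le> K \<longrightarrow>
    L > 0 \<longrightarrow>
    exp (- pi * L + 2 * lam_max_pos T (\<lambda>t. herm1 (A t)) * T + R + 1) \<le> \<epsilon> \<longrightarrow>
    exp (- pi * L + lam_max_neg T (\<lambda>t. herm1 (A t)) * T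
           + lam_max_pos T (\<lambda>t. herm1 (A t)) * T + R + 1) \<le> \<epsilon> \<longrightarrow>
    lam_max_pos T (\<lambda>t. H1g (gam T C\<^sub>T b) (A t) (b t)) * T \<le> p\<gamma> \<longrightarrow>
    \<bar>p\<gamma> - lam_max_pos T (\<lambda>t. herm1 (A t)) * T\<bar> \<le> K * (gam T C\<^sub>T b * b_max T b * T) \<longrightarrow>
    even N \<longrightarrow> N > 0 \<longrightarrow>
    semidiscrete_sol T A b u0 C\<^sub>T L N w \<longrightarrow>
    L2_norm_on {p\<gamma><..<p\<gamma> + R} (\<lambda>p. u_approx L N (w T) p - u T)
      \<le> C * (dp L N * exp (lam_max_pos T (\<lambda>t. herm1 (A t)) * T)
                * (norm (u T) + C\<^sub>T * b_max T b * norm (r0 :: complex^'n))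
              + \<epsilon> * (norm u0 + C\<^sub>T * b_max T b * norm (r0 :: complex^'n)))"
proof -
  obtain \<alpha> where \<alpha>: "\<alpha> \<ge> 0" "\<And>t x. t \<in> {0..T} \<Longrightarrow> norm (A t *v x) \<le> \<alpha> * norm x"
  proof -
    have "bounded (A ` {0..T})"
      by (intro compact_imp_bounded compact_continuous_image assms compact_Icc)
    then obtain B where B: "\<forall>M\<in>A ` {0..T}. norm M \<le> B" unfolding bounded_iff by blast
    obtain k where k: "k \<ge> 0" "\<And>(M :: complex^'n^'n) x. norm (M *v x) \<le> norm M * norm x * k"
      using bounded_bilinear.nonneg_bounded[OF bounded_bilinear_matrix_vector] by blast
    have "norm (A t *v x) \<le> (\<bar>B\<bar> * k) * norm x" if "t \<in> {0..T}" for t x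
    proof -
      have "norm (A t *v x) \<le> norm (A t) * norm x * k" by (rule k)
      also have "\<dots> \<le> \<bar>B\<bar> * norm x * k"
        using bspec[OF B imageI[OF that]] k(1) by (intro mult_right_mono) auto
      finally show ?thesis by (simp add: mult_ac)
    qed
    then show ?thesis using k(1) by (intro that[of "\<bar>B\<bar> * k"]) auto
  qed
  define lamA where "lamA = lam_max_pos T (\<lambda>t. herm1 (A t))"
  \<comment> \<open>The coupling block has norm at most \<gamma> |b| = \<open>1 / C\<^sub>T\<close>,
    hence at most \<open>1 / T\<close>.\<close>
  define Lam where "Lam = \<alpha> + 1 / T"
  \<comment> \<open>A bound for the right end of the recovery interval: the threshold exceeds
    \<open>lamA * T\<close> by at most \<open>K\<close>, since \<gamma> |b| T is at most 1, and
    \<open>R\<close> is at most \<open>exp R\<close>, hence at most \<open>K\<close>. The absolute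
    value keeps \<open>M\<close> nonnegative before the sign of \<open>K\<close> is known.\<close>
  define Q where "Q = lamA * T + 2 * \<bar>K\<bar>"
  define M where "M = Q + Lam * T"
  \<comment> \<open>\<open>C1\<close> serves the case where \<open>M\<close> is at most
    \<open>pi * L\<close>, with \<open>exp (Lam * T)\<close> from going back from time
    \<open>T\<close> to time 0. \<open>C2\<close> serves the other case, with \<open>exp M\<close>
    from the lower bound on \<epsilon>.\<close>
  define C1 where "C1 = 6 * exp Q * exp (Lam * T)"
  define C2 where "C2 = exp Q * (6 * M + 2) * exp M"
  have lamA0: "0 \<le> lamA"
    unfolding lamA_def by (rule lam_max_pos_upper(2)[where t = "T/2" and \<Lambda> = \<alpha>]) (use assms \<alpha> in auto)
  have Lam0: "Lam \<ge> 0" using \<alpha>(1) assms(1) by (simp add: Lam_def)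
  have M0: "M \<ge> 0" using lamA0 Lam0 assms(1) by (simp add: M_def Q_def)
  have C1: "C1 > 0" by (simp add: C1_def)
  have C2: "C2 > 0" using M0 by (simp add: C2_def)
  show ?thesis
  proof (intro exI[of _ "C1 + C2"] conjI allI impI)
    show "C1 + C2 > 0" using C1 C2 by simp
    fix b :: "real \<Rightarrow> complex^'n" and u0 :: "complex^'n" and u :: "real \<Rightarrow> complex^'n"
      and c \<epsilon> R L :: real and N :: nat and p :: real and w :: "real \<Rightarrow> nat \<Rightarrow> complex^('n + 'n)"
    assume b: "continuous_on {0..T} b" "\<exists>t\<in>{0..T}. b t \<noteq> 0" and u0: "u 0 = u0"
      and u: "\<forall>t\<in>{0..T}. (u has_vector_derivative (A t *v u t + b t)) (at t within {0..T})"
      and c: "T \<le> c" "c \<le> K" and \<epsilon>: "\<epsilon> > 0" and R: "R \<ge> 1" "exp R \<le> K" and L: "L > 0"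
      and \<epsilon>1: "exp (- pi * L + 2 * lam_max_pos T (\<lambda>t. herm1 (A t)) * T + R + 1) \<le> \<epsilon>"
      and p: "lam_max_pos T (\<lambda>t. H1g (gam T c b) (A t) (b t)) * T \<le> p"
        "\<bar>p - lam_max_pos T (\<lambda>t. herm1 (A t)) * T\<bar> \<le> K * (gam T c b * b_max T b * T)"
      and N: "even N" "N > 0" and w: "semidiscrete_sol T A b u0 c L N w"
    define g where "g = gam T c b"
    define r where "r = complex_of_real (c * b_max T b)"
    define y where "y t = block_vec (u t) (r *s r0)" for t
    define cs where "cs l = (\<Sum>k<N. inv_N N (Phi L N) l k * psi_h L N k)" for l
    have c0: "c > 0" using c assms(1) by simp
    have bm: "b_max T b > 0" using b b_max_pos by blast
    have g: "of_real g * r = 1" using c0 bm by (simp add: g_def gam_def r_def)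
    have gb: "g * b_max T b = 1 / c" using bm by (simp add: g_def gam_def)
    have g0: "g \<ge> 0" using c0 bm by (simp add: g_def gam_def)
    have cT: "1 / c \<le> 1 / T" using c assms(1) by (simp add: frac_le)
    have bound: "norm (aug_mat g (A t) (b t) *v x) \<le> Lam * norm x" if t: "t \<in> {0..T}" for t x
      unfolding Lam_def
    proof (rule norm_aug_mat_le)
      fix i
      have "cmod (of_real g * b t $ i) = g * cmod (b t $ i)" using g0 by (simp add: norm_mult)
      also have "\<dots> \<le> g * b_max T b" by (intro mult_left_mono norm_le_b_max b t g0)
      finally show "cmod (of_real g * b t $ i) \<le> 1 / T" using gb cT by simp
    qed (use \<alpha> t assms(1) in auto)
    have ode: "(y has_vector_derivative aug_mat g (A t) (b t) *v y t) (at t within {0..T})" if "t \<in> {0..T}" for t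
      unfolding y_def[abs_def] using u that by (intro augmented_ode g) auto
    have w': "((\<lambda>s. w s j) has_vector_derivative
          (- \<i>) *s (of_real (mu L N j) *s (H1g g (A t) (b t) *v w t j) - H2g g (A t) (b t) *v w t j)) (at t within {0..T})"
      if "t \<in> {0..T}" "j < N" for t j
      using w that unfolding semidiscrete_sol_def by (simp add: tensor_mv_Dp tensor_mv_id_N g_def)
    have w0: "w 0 j = cs j *s block_vec (u 0) (r *s r0)" if "j < N" for j
      using w that unfolding semidiscrete_sol_def tensor_mv_mat_1 by (simp add: cs_def r_def u0)
    have cs: "(\<Sum>l<N. cs l * Phi L N k l) = psi_h L N k" if "k < N" for k
      unfolding cs_def by (rule inv_N_Phi_interpolates[OF N(2) L that])
    have K1: "1 \<le> K" using R one_le_exp_iff[of R] by linarith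
    have pR: "p + R \<le> Q"
    proof -
      have "K * (gam T c b * b_max T b * T) = K * (T / c)" using gb by (simp add: g_def)
      also have "\<dots> \<le> K * 1" using c c0 K1 by (intro mult_left_mono) auto
      finally have "p \<le> lamA * T + K" using p(2) unfolding lamA_def by linarith
      moreover have "R \<le> K" using R exp_ge_add_one_self[of R] by linarith
      ultimately show ?thesis using K1 by (simp add: Q_def)
    qed
    have u': "\<And>t. t \<in> {0..T} \<Longrightarrow> (u has_vector_derivative (A t *v u t + b t)) (at t within {0..T})"
      using u by blast
    have "R \<ge> 0" "Q + Lam * T \<le> M" using R by (simp_all add: M_def)
    note err = recovered_error_le[where T = T and A = A and b = b and u = u and w = w and c = cs and g = g
        and r = r and Lam = Lam and N = N and L = L and p = p and R = R and Q = Q and M = M,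
        OF assms b(1) g bound u' w' w0 L N(2,1) cs p(1)[folded g_def] this(1) pR this(2) Lam0, folded y_def]
    have y0: "norm (y 0) \<le> norm u0 + c * b_max T b * norm (r0 :: complex^'n)"
      and yT: "norm (y T) \<le> norm (u T) + c * b_max T b * norm (r0 :: complex^'n)"
      using norm_block_vec_le[of "u 0" "r *s r0"] norm_block_vec_le[of "u T" "r *s r0"] c0 bm
      by (simp_all add: y_def r_def norm_scalar_mult_complex norm_mult u0 del: of_real_mult)
    define a1 where "a1 = norm (u T) + c * b_max T b * norm (r0 :: complex^'n)"
    define a2 where "a2 = norm u0 + c * b_max T b * norm (r0 :: complex^'n)"
    have a: "0 \<le> a1" "0 \<le> a2" using c0 bm by (simp_all add: a1_def a2_def)
    have dp: "0 < dp L N" using L N by (simp add: dp_def)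
    have E1: "1 \<le> exp (lamA * T)" using lamA0 assms(1) by simp
    let ?e = "L2_norm_on {p<..<p + R} (\<lambda>p. u_approx L N (w T) p - u T)"
    have "?e \<le> (C1 + C2) * (dp L N * exp (lamA * T) * a1 + \<epsilon> * a2)"
    proof (cases "pi * L \<ge> M")
      case True
      have "?e \<le> exp Q * (6 * dp L N * norm (y 0))"
        using err(1) True by simp
      also have "\<dots> \<le> exp Q * (6 * dp L N * (exp (Lam * T) * a1))"
      proof (intro mult_left_mono)
        have "norm (y 0) \<le> exp (Lam * T) * norm (y T)"
          by (rule backward_growth_bound[where M = "\<lambda>t. aug_mat g (A t) (b t)"]) (use assms ode bound in auto)
        also have "\<dots> \<le> exp (Lam * T) * a1" using yT by (simp add: a1_def)
        finally show "norm (y 0) \<le> exp (Lam * T) * a1" .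
      qed (use dp in auto)
      also have "\<dots> = C1 * (dp L N * 1 * a1)" by (simp add: C1_def)
      \<comment> \<open>The factor \<open>exp (lamA * T)\<close> is at least 1 and the term with
        \<epsilon> is nonnegative, so both can be inserted.\<close>
      also have "\<dots> \<le> (C1 + C2) * (dp L N * exp (lamA * T) * a1 + \<epsilon> * a2)"
        using C1 C2 dp a E1 \<epsilon>
        by (intro mult_mono add_increasing2 mult_right_mono mult_left_mono mult_nonneg_nonneg) auto
      finally show ?thesis .
    next
      case False
      \<comment> \<open>A short domain forces a large tolerance: if \<open>pi * L < M\<close>, the
        exponent in the assumption on \<epsilon> is at least \<open>- M\<close>, and an error of
        order one is absorbed by \<epsilon>.\<close>
      have "0 \<le> lamA * T" using lamA0 assms(1) by simp
      then have "- M \<le> - pi * L + 2 * lamA * T + R + 1" using False R by linarith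
      then have "exp (- M) \<le> exp (- pi * L + 2 * lamA * T + R + 1)" by (rule exp_le_cancel_iff[THEN iffD2])
      then have "exp (- M) \<le> \<epsilon>" using \<epsilon>1 unfolding lamA_def by linarith
      then have e1: "1 \<le> exp M * \<epsilon>" by (simp add: exp_minus field_simps)
      have "?e \<le> exp Q * ((6 * M + 2) * norm (y 0))"
        using err(2) False by simp
      also have "\<dots> \<le> exp Q * ((6 * M + 2) * (exp M * \<epsilon> * a2))"
      proof (intro mult_left_mono)
        have "norm (y 0) \<le> 1 * a2" using y0 by (simp add: a2_def)
        also have "\<dots> \<le> exp M * \<epsilon> * a2" by (intro mult_right_mono e1 a)
        finally show "norm (y 0) \<le> exp M * \<epsilon> * a2" .
      qed (use M0 in auto)
      also have "\<dots> = C2 * (\<epsilon> * a2)" by (simp add: C2_def)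
      also have "\<dots> \<le> (C1 + C2) * (dp L N * exp (lamA * T) * a1 + \<epsilon> * a2)"
        using C1 C2 dp a \<epsilon>
        by (intro mult_mono add_increasing mult_nonneg_nonneg) auto
      finally show ?thesis .
    qed
    then show "?e \<le> (C1 + C2) * (dp L N * exp (lam_max_pos T (\<lambda>t. herm1 (A t)) * T)
                * (norm (u T) + c * b_max T b * norm (r0 :: complex^'n))
              + \<epsilon> * (norm u0 + c * b_max T b * norm (r0 :: complex^'n)))"
      unfolding lamA_def a1_def a2_def .
  qed
qed

end
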